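(* Let $d\ge 2$ and let $\mathcal N$ be a Poisson random set on $\mathbb R^d$ with intensity measure $\mu$, where $\mu$ is comparable to Lebesgue measure. Let $k\ge 0$ and let $F_n(k)$ be the total award collected by a greedy polyomino of size $n$ on the Voronoi tiling of $\mathcal N$, when the award on a tile equals the $k$-th power of the number of faces of the tile, that is $$F_n(k)=\max_{\mathcal P\in\Pi_n}\sum_{v\in\mathcal P}d_{\mathcal N}(v)^k .$$ Then there are constants $z_0,K\in(0,\infty)$ such that for any $n\ge 1$ and any $z\ge z_0$, $$\mathbb P\left(\frac1n F_n(k)\ge z\right)\le e^{-K(nz)^{\frac{1}{k+2}}}.$$
   Context: Comparability of $\mu$ to Lebesgue measure $\lambda_d$ means that there is a constant $c_\mu>0$ with $\frac1{c_\mu}\lambda_d(A)\le\mu(A)\le c_\mu\lambda_d(A)$ for every Lebesgue-measurable $A\subset\mathbb R^d$. For $v\in\mathcal N$, the Voronoi tile $C_v$ is the set of points of $\mathbb R^d$ at least as close (Euclidean distance) to $v$ as to any other $v'\in\mathcal N$. $d_{\mathcal N}(v)$ is the number of $(d-1)$-dimensional faces of $C_v$. A polyomino $\mathcal P$ of size $n$ is a connected union of $n$ Voronoi tiles; $v\in\mathcal P$ in a sum means that $C_v$ is one of the tiles of $\mathcal P$. $\Pi_n$ is the set of all polyominoes of size $n$ which contain the origin $0\in\mathbb R^d$. *)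

theory Defs
  imports "HOL-Probability.Probability"
begin

definition comparable_to_lebesgue :: "'a::euclidean_space measure \<Rightarrow> bool" where
  "comparable_to_lebesgue \<mu> \<longleftrightarrow> sets \<mu> = sets lebesgue \<and>
     (\<exists>c::real. 0 < c \<and> (\<forall>A\<in>sets lebesgue.
        ennreal (1 / c) * emeasure lebesgue A \<le> emeasure \<mu> A \<and>
        emeasure \<mu> A \<le> ennreal c * emeasure lebesgue A))"

text \<open>The value is \<^term>\<open>\<infinity>\<close> if \<^term>\<open>X \<inter> A\<close> is infinite, whereas
  \<^const>\<open>card\<close> would return 0 there.\<close>

definition point_count :: "'a set \<Rightarrow> 'a set \<Rightarrow> ennreal" where
  "point_count A X = emeasure (count_space UNIV) (X \<inter> A)"

text \<open>The counts of Borel sets are random variables, independent for disjoint sets, and the count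
  of \<^term>\<open>A\<close> is Poisson distributed with mean \<^term>\<open>emeasure \<mu> A\<close> whenever that is finite.
  Summing the Poisson weights over \<^term>\<open>m\<close> shows that such counts are almost surely finite, so
  the random set is almost surely locally finite if \<^term>\<open>\<mu>\<close> is comparable to Lebesgue measure.\<close>

definition poisson_random_set ::
  "'w measure \<Rightarrow> 'a::euclidean_space measure \<Rightarrow> ('w \<Rightarrow> 'a set) \<Rightarrow> bool" where
  "poisson_random_set M \<mu> N \<longleftrightarrow> prob_space M \<and>
     (\<forall>A\<in>sets borel. (\<lambda>\<omega>. point_count A (N \<omega>)) \<in> borel_measurable M) \<and>
     (\<forall>A\<in>sets borel. emeasure \<mu> A < \<infinity> \<longrightarrow>
        (\<forall>m::nat. measure M {\<omega>\<in>space M. point_count A (N \<omega>) = of_nat m} =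
           exp (- measure \<mu> A) * measure \<mu> A ^ m / fact m)) \<and>
     (\<forall>A :: nat \<Rightarrow> 'a set. range A \<subseteq> sets borel \<longrightarrow> disjoint_family A \<longrightarrow>
        prob_space.indep_vars M (\<lambda>_. borel) (\<lambda>i \<omega>. point_count (A i) (N \<omega>)) UNIV)"

definition voronoi_tile :: "'a::euclidean_space set \<Rightarrow> 'a \<Rightarrow> 'a set" where
  "voronoi_tile X v = {x. \<forall>v'\<in>X. dist x v \<le> dist x v'}"

definition num_faces :: "'a::euclidean_space set \<Rightarrow> 'a \<Rightarrow> nat" where
  "num_faces X v =
     card {F. F face_of voronoi_tile X v \<and> aff_dim F = int DIM('a) - 1}"

text \<open>A polyomino is represented by the set of the nuclei of its tiles. For locally finite
  \<^term>\<open>X\<close> the union of the tiles determines this set, since a nucleus lies in no tile but its own.\<close>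

definition polyominoes :: "'a::euclidean_space set \<Rightarrow> nat \<Rightarrow> 'a set set" where
  "polyominoes X n = {P. P \<subseteq> X \<and> finite P \<and> card P = n \<and>
     connected (\<Union>v\<in>P. voronoi_tile X v) \<and> 0 \<in> (\<Union>v\<in>P. voronoi_tile X v)}"

text \<open>For almost every configuration of the Poisson set, all tiles have finitely many faces and
  there are only finitely many, but at least one, polyominoes of size \<^term>\<open>n \<ge> 1\<close> containing the origin.
  The supremum is then the maximum of a finite nonempty set of real numbers.\<close>

definition greedy_award :: "'a::euclidean_space set \<Rightarrow> real \<Rightarrow> nat \<Rightarrow> ennreal" where
  "greedy_award X k n =
     (SUP P\<in>polyominoes X n. ennreal (\<Sum>v\<in>P. real (num_faces X v) powr k))"

end

theory Submission
  imports Defs "HOL-Library.Sublist" "HOL-Real_Asymp.Real_Asymp"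
begin

text \<open>
  Write \<open>d\<close> for the dimension. At every scale \<open>L\<close>, partition the space into cubes of side \<open>L\<close> and
  call a cube bad if it contains no nucleus or more than \<open>C L\<^sup>d\<close> of them. Distinct cubes are bad
  independently, with probability at most \<open>2 exp (- \<alpha> L\<^sup>d)\<close>. If all cubes near a nucleus \<open>v\<close>
  are good, its tile has \<open>O(L\<^sup>d)\<close> faces and only \<open>O(L\<^sup>d)\<close> nuclei are near \<open>v\<close>.

  A lattice path of length \<open>R\<close> started at the origin meets \<open>b\<close> bad cubes of scale \<open>L\<close> with probability at
  most \<open>exp (\<theta> R) (C \<theta>\<^sup>-\<^sup>d p)\<^sup>b\<close>: weight the tuples of visited bad cubes by \<open>exp (- \<theta> \<cdot> length)\<close>. As
  \<open>p\<close> is exponentially small in \<open>L\<^sup>d\<close>, so may be \<open>\<theta>\<close>, and up to probability \<open>exp (- T)\<close> the number of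
  bad cubes met is \<open>O((\<theta> R + T) / L\<^sup>d)\<close>. At a fixed large scale this shows that a polyomino of size
  \<open>n\<close> touches only \<open>O(n + T)\<close> unit cubes, all visited by one path of comparable length, since a
  good cube touched by a tile lies near its nucleus.

  Sort the nuclei of the polyomino by the smallest scale at which their surroundings are good. With
  \<open>T\<close> of order \<open>q\<^sup>d\<close>, no scale above \<open>q\<close> occurs, and summing the awards over the scales up to \<open>q\<close> gives
  at most \<open>O(n + q ^ (d (k + 2)))\<close>. The theorem follows by choosing \<open>q ^ (d (k + 2))\<close> of order \<open>n z\<close>.
\<close>

subsection \<open>Faces of Voronoi tiles\<close>

lemma dist_le_iff_halfspace:
  fixes v w x :: "'a::euclidean_space"
  shows "dist x v \<le> dist x w \<longleftrightarrow> (w - v) \<bullet> x \<le> (w \<bullet> w - v \<bullet> v) / 2"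
proof -
  have "dist x v \<le> dist x w \<longleftrightarrow> (dist x v)\<^sup>2 \<le> (dist x w)\<^sup>2"
    by (simp add: power2_le_iff_abs_le)
  also have "\<dots> \<longleftrightarrow> (w - v) \<bullet> x \<le> (w \<bullet> w - v \<bullet> v) / 2"
    by (simp add: dist_norm power2_norm_eq_inner algebra_simps inner_commute)
  finally show ?thesis .
qed

lemma voronoi_tile_eq_Inter:
  "voronoi_tile X v = (\<Inter>w\<in>X. {x. (w - v) \<bullet> x \<le> (w \<bullet> w - v \<bullet> v) / 2})"
  by (auto simp: voronoi_tile_def dist_le_iff_halfspace)

lemma convex_voronoi_tile: "convex (voronoi_tile X v)"
  unfolding voronoi_tile_eq_Inter by (intro convex_INT convex_halfspace_le)

text \<open>Each facet of the tile is its intersection with the bisector of \<open>v\<close> and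
  some other nucleus, which bounds the facets by the bisectors. Finiteness of \<open>X\<close> makes
  the points of the tile off all bisectors interior.\<close>

lemma num_faces_le_card:
  fixes X :: "'a::euclidean_space set"
  assumes "finite X"
  shows "num_faces X v \<le> card X"
proof -
  define Y where "Y = X - {v}"
  define C where "C = voronoi_tile X v"
  have finY: "finite Y" using assms by (simp add: Y_def)
  define H where "H w = {x::'a. (w - v) \<bullet> x = (w \<bullet> w - v \<bullet> v) / 2}" for w
  have C_Y: "C = (\<Inter>w\<in>Y. {x. (w - v) \<bullet> x \<le> (w \<bullet> w - v \<bullet> v) / 2})"
    unfolding C_def voronoi_tile_eq_Inter Y_def by auto
  have Hface: "(C \<inter> H w) face_of C" if "w \<in> Y" for w
    unfolding H_def
  proof (rule face_of_Int_supporting_hyperplane_le)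
    show "convex C" by (simp add: C_def convex_voronoi_tile)
  qed (use that in \<open>auto simp: C_Y\<close>)
  have interior: "x \<in> interior C" if "x \<in> C" "\<And>w. w \<in> Y \<Longrightarrow> x \<notin> H w" for x
  proof -
    let ?O = "(\<Inter>w\<in>Y. {x. (w - v) \<bullet> x < (w \<bullet> w - v \<bullet> v) / 2})"
    have "open ?O" using finY by (intro open_INT ballI open_halfspace_lt) auto
    moreover have "?O \<subseteq> C" by (force simp: C_Y)
    moreover have "x \<in> ?O" using that by (force simp: C_Y H_def)
    ultimately show ?thesis by (meson interior_maximal subsetD)
  qed
  \<comment> \<open>The point \<open>v\<close> lies strictly on its own side of every bisector, so
    the tile has full dimension.\<close>
  have vint: "v \<in> interior C"
  proof (rule interior)
    show "v \<in> C" by (simp add: C_def voronoi_tile_def)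
    fix w assume "w \<in> Y"
    hence "(w - v) \<bullet> (w - v) > 0" by (auto simp: Y_def)
    thus "v \<notin> H w" by (auto simp: H_def algebra_simps inner_commute)
  qed
  have affC: "aff_dim C = int DIM('a)"
    using vint by (metis aff_dim_nonempty_interior empty_iff)
  have "F \<in> (\<lambda>w. C \<inter> H w) ` Y" if F: "F face_of C" "aff_dim F = int DIM('a) - 1" for F
  proof -
    have "F \<noteq> {}" using F DIM_positive[where 'a='a] by auto
    hence "rel_interior F \<noteq> {}" using F(1) face_of_imp_convex rel_interior_eq_empty by blast
    then obtain x where x: "x \<in> rel_interior F" by blast
    hence xF: "x \<in> F" using rel_interior_subset by blast
    have "F \<noteq> C" using F affC by auto
    hence "F \<inter> rel_interior C = {}" using F(1) by (rule face_of_disjoint_rel_interior[rotated])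
    hence "x \<notin> interior C" using xF interior_subset_rel_interior by blast
    moreover have "x \<in> C" using xF F(1) face_of_imp_subset by blast
    ultimately obtain w where w: "w \<in> Y" "x \<in> H w" using interior by blast
    have sub: "F \<subseteq> C \<inter> H w"
      by (rule subset_of_face_of[OF Hface[OF w(1)]])
        (use F(1) x w \<open>x \<in> C\<close> face_of_imp_subset in auto)
    \<comment> \<open>\<open>C \<inter> H w\<close> is a proper face of \<open>C\<close>. If
      \<open>F\<close> were in turn a proper face of it, two strict drops of dimension would leave
      \<open>F\<close> with dimension at most d - 2.\<close>
    have "F = C \<inter> H w"
    proof (rule ccontr)
      assume ne: "F \<noteq> C \<inter> H w"
      have "F face_of (C \<inter> H w)"
        using face_of_subset[OF F(1) sub] by auto
      hence "aff_dim F < aff_dim (C \<inter> H w)"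
        using ne Hface[OF w(1)] face_of_imp_convex by (intro face_of_aff_dim_lt) auto
      moreover have "aff_dim (C \<inter> H w) < aff_dim C"
      proof (rule face_of_aff_dim_lt)
        show "convex C" by (simp add: C_def convex_voronoi_tile)
        show "(C \<inter> H w) face_of C" using Hface w by auto
        have "(w - v) \<bullet> (w - v) > 0" using w by (auto simp: Y_def)
        hence "v \<notin> H w" by (auto simp: H_def algebra_simps inner_commute)
        thus "C \<inter> H w \<noteq> C" using vint interior_subset by blast
      qed
      ultimately show False using F affC by auto
    qed
    thus ?thesis using w by blast
  qed
  hence "{F. F face_of C \<and> aff_dim F = int DIM('a) - 1} \<subseteq> (\<lambda>w. C \<inter> H w) ` Y" by blast
  hence "num_faces X v \<le> card ((\<lambda>w. C \<inter> H w) ` Y)"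
    unfolding num_faces_def C_def[symmetric] using finY by (intro card_mono) auto
  also have "\<dots> \<le> card Y" using finY card_image_le by blast
  also have "\<dots> \<le> card X" unfolding Y_def using assms by (intro card_mono) auto
  finally show ?thesis .
qed

section \<open>Cubes of side \<open>L\<close> and the geometry near good cubes\<close>

definition cell_idx :: "nat \<Rightarrow> 'a::euclidean_space \<Rightarrow> 'a \<Rightarrow> int" where
  "cell_idx L x = (\<lambda>b\<in>Basis. \<lfloor>(x \<bullet> b) / real L\<rfloor>)"

definition cell :: "nat \<Rightarrow> ('a::euclidean_space \<Rightarrow> int) \<Rightarrow> 'a set" where
  "cell L y = {x. cell_idx L x = y}"

definition nbhd :: "nat \<Rightarrow> ('a::euclidean_space \<Rightarrow> int) \<Rightarrow> ('a \<Rightarrow> int) set" where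
  "nbhd h y = (\<Pi>\<^sub>E b\<in>Basis. {y b - int h..y b + int h})"

text \<open>Badness is membership of the count in a Borel set of extended numbers, so it inherits
  measurability and independence from \<open>point_count\<close>. An infinite count is bad.\<close>

definition bad_cell :: "nat \<Rightarrow> nat \<Rightarrow> 'a::euclidean_space set \<Rightarrow> ('a \<Rightarrow> int) \<Rightarrow> bool" where
  "bad_cell L cap X y \<longleftrightarrow> point_count (cell L y) X \<in> {0} \<union> {of_nat cap<..}"

lemma not_bad_cell_iff:
  "\<not> bad_cell L cap X y \<longleftrightarrow> X \<inter> cell L y \<noteq> {} \<and> finite (X \<inter> cell L y) \<and> card (X \<inter> cell L y) \<le> cap"
  unfolding bad_cell_def point_count_def
  by (auto simp: emeasure_count_space not_less top_unique)

lemma cell_idx_extensional [simp]: "cell_idx L x \<in> extensional Basis"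
  by (simp add: cell_idx_def)

lemma finite_nbhd [simp]: "finite (nbhd h y)"
  unfolding nbhd_def by (intro finite_PiE) auto

lemma card_nbhd:
  "card (nbhd h (y :: 'a::euclidean_space \<Rightarrow> int)) = (2 * h + 1) ^ DIM('a)"
proof -
  have "nat (1 + int h * 2) = 2 * h + 1" by linarith
  thus ?thesis unfolding nbhd_def by (subst card_PiE) (auto simp: algebra_simps)
qed

lemma mem_nbhd_iff:
  "z \<in> nbhd h y \<longleftrightarrow> z \<in> extensional Basis \<and> (\<forall>b\<in>Basis. \<bar>z b - y b\<bar> \<le> int h)"
  unfolding nbhd_def PiE_iff by fastforce

lemma nbhd_commute:
  "y \<in> extensional Basis \<Longrightarrow> z \<in> nbhd h y \<Longrightarrow> y \<in> nbhd h z"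
  by (auto simp: mem_nbhd_iff abs_minus_commute)

lemma floor_diff_le:
  fixes s t :: real
  assumes "\<bar>s - t\<bar> \<le> real h" shows "\<bar>\<lfloor>s\<rfloor> - \<lfloor>t\<rfloor>\<bar> \<le> int h"
proof -
  have "\<lfloor>s\<rfloor> \<le> \<lfloor>t + of_int (int h)\<rfloor>" "\<lfloor>t\<rfloor> \<le> \<lfloor>s + of_int (int h)\<rfloor>"
    using assms by (intro floor_mono; simp; linarith)+
  thus ?thesis by linarith
qed

lemma cell_idx_nbhd:
  fixes x y :: "'a::euclidean_space"
  assumes "dist x y \<le> real h * real L" "L > 0"
  shows "cell_idx L x \<in> nbhd h (cell_idx L y)"
proof -
  have "\<bar>\<lfloor>x \<bullet> b / real L\<rfloor> - \<lfloor>y \<bullet> b / real L\<rfloor>\<bar> \<le> int h" if "b \<in> Basis" for b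
  proof (rule floor_diff_le)
    have "\<bar>x \<bullet> b - y \<bullet> b\<bar> \<le> real h * real L"
      using Basis_le_norm[OF that, of "x - y"] assms(1) by (simp add: inner_diff_left dist_norm)
    thus "\<bar>x \<bullet> b / real L - y \<bullet> b / real L\<bar> \<le> real h"
      using assms(2) by (simp add: diff_divide_distrib[symmetric] abs_divide field_simps)
  qed
  thus ?thesis by (auto simp: mem_nbhd_iff) (simp add: cell_idx_def)
qed

lemma dist_le_of_nbhd:
  fixes x y :: "'a::euclidean_space"
  assumes "cell_idx L x \<in> nbhd h (cell_idx L y)" "L > 0"
  shows "dist x y \<le> real DIM('a) * (real h + 1) * real L"
proof -
  have "dist x y \<le> (\<Sum>b\<in>Basis. \<bar>(x - y) \<bullet> b\<bar>)" unfolding dist_norm by (rule norm_le_l1)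
  also have "\<dots> \<le> (\<Sum>b\<in>(Basis::'a set). (real h + 1) * real L)"
  proof (rule sum_mono)
    fix b :: 'a assume b: "b \<in> Basis"
    have "\<bar>\<lfloor>x \<bullet> b / real L\<rfloor> - \<lfloor>y \<bullet> b / real L\<rfloor>\<bar> \<le> int h"
      using assms(1) b by (auto simp: mem_nbhd_iff cell_idx_def)
    hence "\<bar>x \<bullet> b / real L - y \<bullet> b / real L\<bar> \<le> real h + 1" by linarith
    thus "\<bar>(x - y) \<bullet> b\<bar> \<le> (real h + 1) * real L"
      using assms(2) by (simp add: inner_diff_left diff_divide_distrib[symmetric] abs_divide field_simps)
  qed
  finally show ?thesis by simp
qed

lemma dist_le_same_cell:
  fixes x y :: "'a::euclidean_space"
  assumes "cell_idx L x = cell_idx L y" "L > 0"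
  shows "dist x y \<le> real DIM('a) * real L"
proof -
  have "cell_idx L x \<in> nbhd 0 (cell_idx L y)" using assms by (simp add: mem_nbhd_iff)
  from dist_le_of_nbhd[OF this assms(2)] show ?thesis by simp
qed

text \<open>A good cell contains a nucleus, and a point of the cell that belongs to the tile of
  \<open>v\<close> is at least as close to \<open>v\<close> as to that nucleus.\<close>

lemma dist_le_of_not_bad:
  fixes x v :: "'a::euclidean_space"
  assumes "x \<in> voronoi_tile X v" "\<not> bad_cell L cap X (cell_idx L x)" "L > 0"
  shows "dist x v \<le> real DIM('a) * real L"
proof -
  obtain w where w: "w \<in> X" "cell_idx L w = cell_idx L x"
    using assms(2) unfolding not_bad_cell_iff by (auto simp: cell_def)
  hence "dist x v \<le> dist x w" using assms(1) by (auto simp: voronoi_tile_def)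
  also have "\<dots> \<le> real DIM('a) * real L" using w assms(3) by (intro dist_le_same_cell) auto
  finally show ?thesis .
qed

lemma card_near_le:
  fixes y :: "'a::euclidean_space \<Rightarrow> int"
  assumes "\<And>z. z \<in> nbhd h y \<Longrightarrow> \<not> bad_cell L cap X z"
  shows "finite {v\<in>X. cell_idx L v \<in> nbhd h y}"
    and "card {v\<in>X. cell_idx L v \<in> nbhd h y} \<le> (2 * h + 1) ^ DIM('a) * cap"
proof -
  have eq: "{v\<in>X. cell_idx L v \<in> nbhd h y} = (\<Union>z\<in>nbhd h y. X \<inter> cell L z)"
    by (auto simp: cell_def)
  show "finite {v\<in>X. cell_idx L v \<in> nbhd h y}"
    unfolding eq using assms by (intro finite_UN_I) (auto simp: not_bad_cell_iff)
  have "card {v\<in>X. cell_idx L v \<in> nbhd h y} \<le> (\<Sum>z\<in>nbhd h y. card (X \<inter> cell L z))"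
    unfolding eq by (rule card_UN_le) simp
  also have "\<dots> \<le> (\<Sum>z\<in>nbhd h y. cap)"
    using assms by (intro sum_mono) (auto simp: not_bad_cell_iff)
  finally show "card {v\<in>X. cell_idx L v \<in> nbhd h y} \<le> (2 * h + 1) ^ DIM('a) * cap"
    by (simp add: card_nbhd)
qed

text \<open>A tile surrounded by occupied cells is cut out by the nuclei in these cells.\<close>

lemma num_faces_le_of_good:
  fixes v :: "'a::euclidean_space"
  assumes h: "2 * DIM('a) + 2 \<le> h" and L: "L > 0"
    and good: "\<And>z. z \<in> nbhd h (cell_idx L v) \<Longrightarrow> \<not> bad_cell L cap X z"
  shows "num_faces X v \<le> (2 * h + 1) ^ DIM('a) * cap"
proof -
  define Y where "Y = {w\<in>X. cell_idx L w \<in> nbhd h (cell_idx L v)}"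
  \<comment> \<open>\<open>\<rho>\<close> exceeds the distance \<open>d * L\<close> within which a
    good cell guarantees a nucleus, while \<open>2 * \<rho>\<close> stays inside the good
    neighbourhood; hence the lower bound on \<open>h\<close>.\<close>
  define \<rho> where "\<rho> = (real DIM('a) + 1) * real L"
  have \<rho>: "real DIM('a) * real L < \<rho>" "\<rho> > 0" using L by (auto simp: \<rho>_def)
  have \<rho>h: "2 * \<rho> \<le> real h * real L"
  proof -
    have "real (2 * DIM('a) + 2) \<le> real h" using h by linarith
    thus ?thesis using mult_right_mono[of "real (2 * DIM('a) + 2)" "real h" "real L"]
      by (simp add: \<rho>_def algebra_simps)
  qed
  \<comment> \<open>By convexity, a tile reaching beyond \<open>\<rho>\<close> contains a point
    \<open>x'\<close> at distance exactly \<open>\<rho>\<close> from \<open>v\<close>. The cell of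
    \<open>x'\<close> is good, so some nucleus of \<open>Y\<close> is closer to \<open>x'\<close>
    than \<open>v\<close> is.\<close>
  have bounded: "dist x v \<le> \<rho>" if x: "x \<in> voronoi_tile Y v" for x
  proof (rule ccontr)
    assume "\<not> dist x v \<le> \<rho>"
    hence gt: "dist x v > \<rho>" by simp
    define t where "t = \<rho> / dist x v"
    have t: "0 < t" "t < 1" using gt \<rho> by (auto simp: t_def divide_simps)
    define x' where "x' = (1 - t) *\<^sub>R v + t *\<^sub>R x"
    have "v \<in> voronoi_tile Y v" by (simp add: voronoi_tile_def)
    hence x': "x' \<in> voronoi_tile Y v"
      using convex_voronoi_tile x t unfolding x'_def convex_def by fastforce
    have "x' - v = t *\<^sub>R (x - v)" by (simp add: x'_def algebra_simps)
    hence d: "dist x' v = \<rho>" using t gt \<rho> by (auto simp: dist_norm t_def)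
    have near: "cell_idx L x' \<in> nbhd h (cell_idx L v)"
      using d \<rho>h \<rho> L by (intro cell_idx_nbhd) auto
    then obtain w where w: "w \<in> X" "cell_idx L w = cell_idx L x'"
      using good unfolding not_bad_cell_iff by (fastforce simp: cell_def)
    hence "w \<in> Y" using near by (simp add: Y_def)
    hence "dist x' v \<le> dist x' w" using x' by (auto simp: voronoi_tile_def)
    also have "\<dots> \<le> real DIM('a) * real L" using w L by (intro dist_le_same_cell) auto
    finally show False using d \<rho> by simp
  qed
  have "voronoi_tile X v = voronoi_tile Y v"
  proof
    show "voronoi_tile X v \<subseteq> voronoi_tile Y v" by (auto simp: voronoi_tile_def Y_def)
    show "voronoi_tile Y v \<subseteq> voronoi_tile X v"
    proof
      fix x assume x: "x \<in> voronoi_tile Y v"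
      have "dist x v \<le> dist x w" if w: "w \<in> X" for w
      proof (cases "w \<in> Y")
        case True thus ?thesis using x by (auto simp: voronoi_tile_def)
      next
        case False
        \<comment> \<open>A nucleus outside \<open>Y\<close> is farther than
          \<open>2 * \<rho>\<close> from \<open>v\<close>, hence farther than \<open>\<rho>\<close>
          from every point of the tile of \<open>Y\<close>, and cuts nothing off.\<close>
        hence "\<not> dist w v \<le> real h * real L" using w L cell_idx_nbhd by (auto simp: Y_def)
        hence "dist w v > 2 * \<rho>" using \<rho>h by simp
        moreover have "dist w v \<le> dist x w + dist x v"
          by (metis dist_commute dist_triangle)
        ultimately show ?thesis using bounded[OF x] by simp
      qed
      thus "x \<in> voronoi_tile X v" by (simp add: voronoi_tile_def)
    qed
  qed
  hence "num_faces X v = num_faces Y v" by (simp add: num_faces_def)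
  also have "\<dots> \<le> card Y"
    using card_near_le(1)[OF good] by (intro num_faces_le_card) (simp add: Y_def)
  also have "\<dots> \<le> (2 * h + 1) ^ DIM('a) * cap"
    using card_near_le(2)[OF good] by (simp add: Y_def)
  finally show ?thesis .
qed

subsection \<open>Lattice paths through bad cells\<close>

text \<open>The l1 distance, for which the weight \<open>exp (- \<theta> * idx_dist a y)\<close>
  factors over the coordinates.\<close>

definition idx_dist :: "('a::euclidean_space \<Rightarrow> int) \<Rightarrow> ('a \<Rightarrow> int) \<Rightarrow> real" where
  "idx_dist f g = (\<Sum>b\<in>Basis. \<bar>real_of_int (f b - g b)\<bar>)"

lemma idx_dist_nonneg [simp]: "0 \<le> idx_dist f g"
  by (simp add: idx_dist_def sum_nonneg)

lemma idx_dist_commute: "idx_dist f g = idx_dist g f"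
  by (simp add: idx_dist_def abs_minus_commute)

lemma idx_dist_triangle: "idx_dist f h \<le> idx_dist f g + idx_dist g h"
  unfolding idx_dist_def sum.distrib[symmetric] by (intro sum_mono) auto

lemma idx_dist_le_nbhd:
  fixes y z :: "'a::euclidean_space \<Rightarrow> int"
  assumes "z \<in> nbhd h y"
  shows "idx_dist z y \<le> real DIM('a) * real h"
proof -
  have "idx_dist z y \<le> (\<Sum>b\<in>(Basis::'a set). real h)"
    unfolding idx_dist_def
  proof (rule sum_mono)
    fix b :: 'a assume "b \<in> Basis"
    hence "\<bar>z b - y b\<bar> \<le> int h" using assms by (auto simp: mem_nbhd_iff)
    thus "\<bar>real_of_int (z b - y b)\<bar> \<le> real h" by linarith
  qed
  thus ?thesis by simp
qed

fun path_length :: "('a::euclidean_space \<Rightarrow> int) \<Rightarrow> ('a \<Rightarrow> int) list \<Rightarrow> real" where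
  "path_length a [] = 0"
| "path_length a (x # xs) = idx_dist a x + path_length x xs"

lemma path_length_nonneg [simp]: "0 \<le> path_length a xs"
  by (induction xs arbitrary: a) auto

lemma path_length_triangle: "path_length a xs \<le> idx_dist a c + path_length c xs"
  by (cases xs) (auto simp: idx_dist_triangle)

text \<open>By the triangle inequality, leaving out points does not lengthen a path. This allows
  keeping only the bad cells met by a walk.\<close>

lemma path_length_subseq: "subseq ys xs \<Longrightarrow> path_length a ys \<le> path_length a xs"
proof (induction arbitrary: a rule: list_emb.induct)
  case (list_emb_Cons xs ys y)
  have "path_length a xs \<le> path_length a ys" by (rule list_emb_Cons.IH)
  also have "\<dots> \<le> path_length a (y # ys)" using path_length_triangle by simp
  finally show ?case .
qed (auto simp: add_mono)

lemma path_length_successively_le: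
  assumes "\<And>x y. R x y \<Longrightarrow> idx_dist (g x) (g y) \<le> D" "successively R (a # xs)"
  shows "path_length (g a) (map g xs) \<le> D * length xs"
  using assms(2)
proof (induction xs arbitrary: a)
  case (Cons x xs)
  thus ?case using assms(1)[of a x] by (auto simp: algebra_simps intro: add_mono)
qed simp

lemma subseq_take: "subseq (take n xs) xs"
  by (simp add: prefix_imp_subseq take_is_prefix)

lemma subseq_remdups: "subseq (remdups xs) xs"
  by (induction xs) auto

lemma idx_dist_mem_le:
  assumes "x \<in> set xs" shows "idx_dist a x \<le> path_length a xs"
proof -
  have "subseq [x] xs" using assms by (metis subseq_singleton_left)
  from path_length_subseq[OF this, of a] show ?thesis by simp
qed

text \<open>Visiting a new vertex by a detour of two steps costs at most \<open>2 m\<close> steps for \<open>m\<close> vertices.\<close>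

lemma exists_covering_walk:
  assumes "a \<in> S"
    and conn: "\<And>A. A \<subseteq> S \<Longrightarrow> a \<in> A \<Longrightarrow> A \<noteq> S \<Longrightarrow> \<exists>x\<in>A. \<exists>y\<in>S - A. R x y \<and> R y x"
  shows "\<exists>xs. successively R (a # xs) \<and> set xs \<subseteq> S \<and> length xs \<le> 2 * m \<and>
    (m < card (set (a # xs)) \<or> set (a # xs) = S)"
proof (induction m)
  case 0
  show ?case using assms(1) by (intro exI[of _ "[]"]) auto
next
  case (Suc m)
  then obtain xs where xs: "successively R (a # xs)" "set xs \<subseteq> S" "length xs \<le> 2 * m"
    "m < card (set (a # xs)) \<or> set (a # xs) = S" by blast
  show ?case
  proof (cases "set (a # xs) = S")
    case True
    thus ?thesis using xs by (intro exI[of _ xs]) auto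
  next
    case False
    obtain x y where xy: "x \<in> set (a # xs)" "y \<in> S" "y \<notin> set (a # xs)" "R x y" "R y x"
      using conn[of "set (a # xs)"] False xs assms(1) by auto
    obtain us vs where split: "a # xs = us @ x # vs" using xy(1) by (meson split_list)
    obtain ys where ys: "a # ys = us @ x # y # x # vs"
      using split by (cases us) auto
    have "successively R (us @ x # y # x # vs)"
      using xs(1) xy(4,5) unfolding split
      by (auto simp: successively_append_iff)
    moreover have set_ys: "set (a # ys) = insert y (set (a # xs))"
      unfolding ys split by auto
    moreover have "length (a # ys) = length (a # xs) + 2" unfolding ys split by simp
    moreover have "Suc m < card (set (a # ys))"
      using False xs(4) xy(3) unfolding set_ys by simp
    moreover have "set ys \<subseteq> S"
      using set_ys xs(2) xy(2) assms(1) by (metis insert_subset list.simps(15))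
    ultimately show ?thesis using xs(3) unfolding ys[symmetric]
      by (intro exI[of _ ys]) auto
  qed
qed

text \<open>The index of the cube of side \<open>L\<close> that contains the unit cube of index
  \<open>i\<close>; like the floor in \<open>cell_idx\<close>, \<open>div\<close> rounds down for
  negative coordinates too.\<close>

definition coarse :: "nat \<Rightarrow> ('a::euclidean_space \<Rightarrow> int) \<Rightarrow> 'a \<Rightarrow> int" where
  "coarse L i = (\<lambda>b\<in>Basis. i b div int L)"

lemma coarse_extensional [simp]: "coarse L i \<in> extensional Basis"
  by (simp add: coarse_def)

lemma coarse_cell_idx: "coarse L (cell_idx 1 x) = cell_idx L x"
proof -
  have "\<lfloor>r\<rfloor> div int L = \<lfloor>r / real L\<rfloor>" for r :: real
    using floor_divide_real_eq_div[of "int L" r] by simp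
  thus ?thesis by (auto simp: coarse_def cell_idx_def restrict_def)
qed

lemma coarse_nbhd:
  assumes "i \<in> nbhd 1 j" "L > 0" shows "coarse L i \<in> nbhd 1 (coarse L j)"
proof -
  have "\<bar>i b div int L - j b div int L\<bar> \<le> 1" if "b \<in> Basis" for b
  proof -
    have ij: "i b \<le> j b + 1" "j b \<le> i b + 1" using assms that by (force simp: mem_nbhd_iff)+
    have *: "(k + 1) div int L \<le> k div int L + 1" for k
    proof -
      have "(k + 1) div int L \<le> (k + int L) div int L"
        using assms(2) by (intro zdiv_mono1) auto
      thus ?thesis using assms(2) by simp
    qed
    show ?thesis
      using zdiv_mono1[OF ij(1), of "int L"] zdiv_mono1[OF ij(2), of "int L"]
        *[of "j b"] *[of "i b"] assms(2) by simp
  qed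
  thus ?thesis by (auto simp: mem_nbhd_iff) (simp add: coarse_def)
qed

lemma card_coarse_fibre:
  fixes w :: "'a::euclidean_space \<Rightarrow> int"
  assumes "L > 0"
  shows "finite {i \<in> extensional Basis. coarse L i = w}" (is "finite ?A")
    and "card {i \<in> extensional Basis. coarse L i = w} \<le> L ^ DIM('a)"
proof -
  let ?B = "\<Pi>\<^sub>E b\<in>(Basis::'a set). {int L * w b..<int L * w b + int L}"
  have sub: "?A \<subseteq> ?B"
  proof
    fix i assume i: "i \<in> ?A"
    have "int L * w b \<le> i b \<and> i b < int L * w b + int L" if "b \<in> Basis" for b
    proof -
      have "w b = i b div int L" using i that by (auto simp: coarse_def)
      moreover have "0 \<le> i b mod int L" "i b mod int L < int L" using assms by auto
      moreover have "int L * w b + i b mod int L = i b" using \<open>w b = _\<close> by simp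
      moreover have "p \<le> i b \<and> i b < p + l" if "0 \<le> r" "r < l" "p + r = i b" for p r l :: int
        using that by linarith
      ultimately show ?thesis by blast
    qed
    thus "i \<in> ?B" using i by (auto simp: PiE_iff)
  qed
  have "finite ?B" by (intro finite_PiE) auto
  moreover have "card ?B = L ^ DIM('a)" by (subst card_PiE) auto
  ultimately show "finite ?A" "card ?A \<le> L ^ DIM('a)"
    using sub finite_subset card_mono[OF _ sub] by auto
qed

text \<open>Only the bad cells are recorded, and the length is that of the shortcuts between them.
  Distinctness makes independence applicable. An index outside \<open>extensional Basis\<close> has
  an empty cell, which would count as bad.\<close>

definition bad_path :: "nat \<Rightarrow> nat \<Rightarrow> real \<Rightarrow> nat \<Rightarrow> 'a::euclidean_space set \<Rightarrow> bool" where
  "bad_path L cap R b X \<longleftrightarrow> (\<exists>ys. length ys = b \<and> distinct ys \<and> set ys \<subseteq> extensional Basis \<and>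
     path_length (cell_idx L 0) ys \<le> R \<and> (\<forall>y\<in>set ys. bad_cell L cap X y))"

text \<open>Each \<open>w\<close> in \<open>W\<close> is charged to a bad cell within distance
  \<open>h\<close>. The walk, diverted to these bad cells, has length at most \<open>R\<close>, so
  there are fewer than \<open>b\<close> of them, and each is charged at most
  \<open>(2 * h + 1) ^ d\<close> times.\<close>

lemma card_near_bad_le:
  fixes X :: "'a::euclidean_space set"
  assumes walk: "successively (\<lambda>i j. i \<in> nbhd 1 j) (cell_idx 1 0 # xs)" "set xs \<subseteq> extensional Basis"
    and L: "L > 0"
    and W: "W \<subseteq> coarse L ` set (cell_idx 1 0 # xs)"
      "\<And>w. w \<in> W \<Longrightarrow> \<exists>z\<in>nbhd h w. bad_cell L cap X z"
    and no: "\<not> bad_path L cap R b X"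
    and R: "real (DIM('a) * (2 * h + 1) * (length xs + 1)) \<le> R"
  shows "card W \<le> (2 * h + 1) ^ DIM('a) * (b - 1)"
proof -
  let ?o = "cell_idx 1 (0::'a)"
  have finW: "finite W" by (rule finite_subset[OF W(1)]) auto
  have "\<forall>w\<in>W. \<exists>z. z \<in> nbhd h w \<and> bad_cell L cap X z" using W(2) by blast
  from bchoice[OF this] obtain f where f': "\<forall>w\<in>W. f w \<in> nbhd h w \<and> bad_cell L cap X (f w)"
    by blast
  have f: "f w \<in> nbhd h w" "bad_cell L cap X (f w)" if "w \<in> W" for w
    using f' that by simp_all
  \<comment> \<open>The walk at scale \<open>L\<close>, with each index of \<open>W\<close> replaced
    by its bad cell. Every point moves by at most \<open>h\<close> per coordinate, so a step costs
    at most \<open>d * (2 * h + 1)\<close>.\<close>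
  define g where "g i = (if coarse L i \<in> W then f (coarse L i) else coarse L i)" for i
  have g_near: "g i \<in> nbhd h (coarse L i)" for i
  proof (cases "coarse L i \<in> W")
    case True
    thus ?thesis using f(1) by (simp add: g_def)
  qed (simp add: g_def mem_nbhd_iff)
  have g_dist: "idx_dist (g i) (g j) \<le> real (DIM('a) * (2 * h + 1))" if "i \<in> nbhd 1 j" for i j
  proof -
    have "idx_dist (g i) (g j) \<le> idx_dist (g i) (coarse L i) + idx_dist (coarse L i) (coarse L j)
        + idx_dist (g j) (coarse L j)"
      using idx_dist_triangle[of "g i" "g j" "coarse L i"]
        idx_dist_triangle[of "coarse L i" "g j" "coarse L j"]
        idx_dist_commute[of "coarse L j" "g j"] by linarith
    also have "\<dots> \<le> real DIM('a) * real h + real DIM('a) * real 1 + real DIM('a) * real h"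
      by (intro add_mono idx_dist_le_nbhd g_near coarse_nbhd that L)
    finally show ?thesis by (simp add: algebra_simps)
  qed
  define zs where "zs = map g (?o # xs)"
  have "path_length (g ?o) (map g xs) \<le> real (DIM('a) * (2 * h + 1)) * length xs"
    by (rule path_length_successively_le[OF g_dist walk(1)])
  \<comment> \<open>The jump from the cell of the origin to the first point accounts for the
    \<open>+ 1\<close> in the bound on the length.\<close>
  moreover have "idx_dist (coarse L ?o) (g ?o) \<le> real (DIM('a) * (2 * h + 1))"
  proof -
    have "idx_dist (coarse L ?o) (g ?o) \<le> real DIM('a) * real h"
      unfolding idx_dist_commute[of "coarse L ?o"] by (rule idx_dist_le_nbhd[OF g_near])
    also have "\<dots> \<le> real (DIM('a) * (2 * h + 1))" by (simp add: algebra_simps)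
    finally show ?thesis .
  qed
  moreover have "path_length (cell_idx L 0) zs =
      idx_dist (coarse L ?o) (g ?o) + path_length (g ?o) (map g xs)"
    by (simp only: zs_def list.map path_length.simps coarse_cell_idx)
  moreover have "real (DIM('a) * (2 * h + 1)) * real (length xs) + real (DIM('a) * (2 * h + 1)) =
      real (DIM('a) * (2 * h + 1) * (length xs + 1))"
    by (simp add: algebra_simps)
  ultimately have "path_length (cell_idx L 0) zs \<le> real (DIM('a) * (2 * h + 1) * (length xs + 1))"
    by linarith
  hence len: "path_length (cell_idx L 0) zs \<le> R" using R by linarith
  define B where "B = f ` W"
  have B_zs: "B \<subseteq> set zs"
  proof
    fix z assume "z \<in> B"
    then obtain w where w: "w \<in> W" "z = f w" unfolding B_def by blast
    then obtain i where i: "i \<in> set (?o # xs)" "w = coarse L i" using W(1) by blast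
    have "z \<in> g ` set (?o # xs)" using w i by (intro image_eqI[of _ _ i]) (simp_all add: g_def)
    thus "z \<in> set zs" by (simp only: zs_def set_map)
  qed
  have "card B < b"
  proof (rule ccontr)
    assume "\<not> card B < b"
    \<comment> \<open>All of \<open>B\<close>, listed in an order in which the walk meets it; a
      sublist of \<open>zs\<close> is no longer than \<open>zs\<close>.\<close>
    define us where "us = filter (\<lambda>z. z \<in> B) (remdups zs)"
    define ys where "ys = take b us"
    have us: "distinct us" "set us = B" using B_zs by (auto simp: us_def)
    have "length us = card B" using distinct_card[OF us(1)] us(2) by simp
    hence "length ys = b" using \<open>\<not> card B < b\<close> by (simp add: ys_def)
    moreover have "distinct ys" using us by (simp add: ys_def)
    moreover have ysB: "set ys \<subseteq> B"
      using set_take_subset[of b us] unfolding ys_def us(2) .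
    moreover have "B \<subseteq> extensional Basis" using f(1) unfolding B_def mem_nbhd_iff by blast
    hence "set ys \<subseteq> extensional Basis" using ysB by blast
    moreover have "subseq ys zs"
      unfolding ys_def us_def
      by (rule subseq_order.order_trans[OF subseq_take
        subseq_order.order_trans[OF subseq_filter_left subseq_remdups]])
    hence "path_length (cell_idx L 0) ys \<le> R" by (rule order_trans[OF path_length_subseq len])
    moreover have "\<forall>y\<in>set ys. bad_cell L cap X y" using ysB f(2) unfolding B_def by blast
    ultimately show False using no unfolding bad_path_def by blast
  qed
  have "W \<subseteq> (\<Union>z\<in>B. nbhd h z)"
  proof
    fix w assume w: "w \<in> W"
    then obtain i where "w = coarse L i" using W(1) by blast
    hence "w \<in> extensional Basis" by simp
    hence "w \<in> nbhd h (f w)" using f(1)[OF w] by (rule nbhd_commute)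
    thus "w \<in> (\<Union>z\<in>B. nbhd h z)" using w unfolding B_def by blast
  qed
  hence "card W \<le> card (\<Union>z\<in>B. nbhd h z)" using finW by (intro card_mono) (auto simp: B_def)
  also have "\<dots> \<le> (\<Sum>z\<in>B. card (nbhd h z))" using finW by (intro card_UN_le) (auto simp: B_def)
  also have "\<dots> = card B * (2 * h + 1) ^ DIM('a)" by (simp add: card_nbhd)
  also have "\<dots> \<le> (b - 1) * (2 * h + 1) ^ DIM('a)" using \<open>card B < b\<close> by (intro mult_right_mono) auto
  finally show ?thesis by (simp add: mult.commute)
qed

subsection \<open>The award of a polyomino\<close>

text \<open>\<open>P\<close> is not assumed monotone, since surroundings that are good at one scale
  may be bad at a larger one.\<close>

lemma exists_level_change:
  assumes "\<not> P (a::nat)" "P c" "a \<le> c"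
  shows "\<exists>L\<in>{a..<c}. \<not> P L \<and> P (Suc L)"
proof (rule ccontr)
  assume no: "\<not> ?thesis"
  have "L \<le> c \<longrightarrow> \<not> P L" if "a \<le> L" for L
    using that
  proof (induction L rule: dec_induct)
    case base
    thus ?case using assms(1) by simp
  next
    case (step L)
    thus ?case using no by auto
  qed
  from this[of c] assms show False by simp
qed

definition good_at :: "nat \<Rightarrow> nat \<Rightarrow> nat \<Rightarrow> 'a::euclidean_space set \<Rightarrow> 'a \<Rightarrow> bool" where
  "good_at h cap L X v \<longleftrightarrow> (\<forall>z\<in>nbhd h (cell_idx L v). \<not> bad_cell L cap X z)"

text \<open>Points at distance below 1 lie in neighbouring unit cells. If no cell of
  \<open>A\<close> had a neighbour among the remaining ones, lying in a cell of \<open>A\<close>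
  would be locally constant on the connected set \<open>U\<close>. As \<open>U\<close> is not known
  to be bounded, the walk may stop once it has seen more than \<open>m\<close> cells.\<close>

lemma exists_cell_walk:
  fixes U :: "'a::euclidean_space set"
  assumes "connected U" "0 \<in> U"
  shows "\<exists>xs. successively (\<lambda>i j. i \<in> nbhd 1 j) (cell_idx 1 0 # xs) \<and> set xs \<subseteq> cell_idx 1 ` U \<and>
    length xs \<le> 2 * m \<and>
    (m < card (set (cell_idx 1 0 # xs)) \<or> set (cell_idx 1 0 # xs) = cell_idx 1 ` U)"
proof (rule exists_covering_walk)
  fix A assume A: "A \<subseteq> cell_idx 1 ` U" "cell_idx 1 0 \<in> A" "A \<noteq> cell_idx 1 ` U"
  show "\<exists>x\<in>A. \<exists>y\<in>cell_idx 1 ` U - A. x \<in> nbhd 1 y \<and> y \<in> nbhd 1 x"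
  proof (rule ccontr)
    assume no: "\<not> ?thesis"
    obtain u where u: "u \<in> U" "cell_idx 1 u \<notin> A" using A by blast
    have "(cell_idx 1 u \<in> A) = (cell_idx 1 0 \<in> A)"
    proof (rule connected_local_const[OF assms(1) u(1) assms(2)], rule ballI)
      fix x assume x: "x \<in> U"
      have "(cell_idx 1 x \<in> A) = (cell_idx 1 y \<in> A)" if "y \<in> U" "dist y x < 1" for y
      proof -
        have "cell_idx 1 x \<in> nbhd 1 (cell_idx 1 y)" "cell_idx 1 y \<in> nbhd 1 (cell_idx 1 x)"
          using that by (intro cell_idx_nbhd; simp add: dist_commute)+
        thus ?thesis using no x that by blast
      qed
      thus "eventually (\<lambda>y. (cell_idx 1 x \<in> A) = (cell_idx 1 y \<in> A)) (at x within U)"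
        unfolding eventually_at by (intro exI[of _ 1]) auto
    qed
    thus False using u A by simp
  qed
qed (use assms in auto)

section \<open>Deterministic bounds along one walk through unit cells\<close>

context
  fixes X P :: "'a::euclidean_space set" and h :: nat and cap b :: "nat \<Rightarrow> nat"
    and xs :: "('a \<Rightarrow> int) list" and R :: real
  assumes h: "2 * DIM('a) + 2 \<le> h"
    and P: "P \<subseteq> X" "finite P"
    and walk: "successively (\<lambda>i j. i \<in> nbhd 1 j) (cell_idx 1 0 # xs)" "set xs \<subseteq> extensional Basis"
    and R: "real (DIM('a) * (2 * h + 1) * (length xs + 1)) \<le> R"
begin

text \<open>A nucleus that is bad at \<open>L\<^sub>0\<close> is bad at some \<open>L\<close> and
  good at \<open>Suc L\<close>. Badness at \<open>L\<close> leaves few cells of scale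
  \<open>L\<close> for it; goodness at \<open>Suc L\<close> bounds both the nuclei in such a cell
  and the faces of the tile.\<close>

lemma sum_faces_le:
  fixes q L\<^sub>0 :: nat and k :: real
  defines "g \<equiv> \<lambda>L. real ((2 * h + 1) ^ DIM('a) * cap L) powr k"
  assumes L0: "0 < L\<^sub>0" "L\<^sub>0 \<le> q" and k: "0 \<le> k"
    and no: "\<And>L. L\<^sub>0 \<le> L \<Longrightarrow> L \<le> q \<Longrightarrow> \<not> bad_path L (cap L) R (b L) X"
    and bq: "b q = 1"
    and vis: "cell_idx 1 ` P \<subseteq> set (cell_idx 1 0 # xs)"
  shows "(\<Sum>v\<in>P. real (num_faces X v) powr k) \<le> real (card P) * g L\<^sub>0 +
    (\<Sum>L = L\<^sub>0..<q. real ((2 * h + 1) ^ DIM('a) * (b L - 1)) *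
      real ((2 * h + 1) ^ DIM('a) * cap (Suc L)) * g (Suc L))"
proof -
  let ?c = "(2 * h + 1) ^ DIM('a)"
  define G where "G L v \<longleftrightarrow> good_at h (cap L) L X v" for L v
  have g0: "0 \<le> g L" for L by (simp add: g_def)
  have faces: "real (num_faces X v) powr k \<le> g L" if "G L v" "0 < L" for v L
  proof -
    have "num_faces X v \<le> ?c * cap L"
      using that by (intro num_faces_le_of_good h) (auto simp: G_def good_at_def)
    thus ?thesis unfolding g_def using k by (intro powr_mono2) (simp_all only: of_nat_le_iff of_nat_0_le_iff)
  qed
  define W where "W L = cell_idx L ` {v\<in>P. \<not> G L v}" for L
  have W: "card (W L) \<le> ?c * (b L - 1)" if "L\<^sub>0 \<le> L" "L \<le> q" for L
  proof (rule card_near_bad_le[OF walk])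
    show "W L \<subseteq> coarse L ` set (cell_idx 1 0 # xs)"
    proof
      fix w assume "w \<in> W L"
      then obtain v where v: "v \<in> P" "w = cell_idx L v" unfolding W_def by blast
      hence "w = coarse L (cell_idx 1 v)" by (simp only: coarse_cell_idx)
      thus "w \<in> coarse L ` set (cell_idx 1 0 # xs)" using v vis by blast
    qed
    show "\<exists>z\<in>nbhd h w. bad_cell L (cap L) X z" if "w \<in> W L" for w
      using that by (auto simp: W_def G_def good_at_def)
    show "\<not> bad_path L (cap L) R (b L) X" using no that by simp
  qed (use that L0 R in auto)
  \<comment> \<open>With \<open>b q = 1\<close> no bad cell of scale \<open>q\<close> is near a
    nucleus, so every nucleus is good at the last scale.\<close>
  have Gq: "G q v" if "v \<in> P" for v
  proof (rule ccontr)
    assume "\<not> G q v"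
    moreover have "finite (W q)" using P by (simp add: W_def)
    moreover have "card (W q) = 0" using W[of q] bq L0 by simp
    ultimately show False using that by (auto simp: W_def)
  qed
  define S where "S L = {v\<in>P. \<not> G L v \<and> G (Suc L) v}" for L
  have finS: "finite (S L)" for L using P by (simp add: S_def)
  have cardS: "card (S L) \<le> ?c * (b L - 1) * (?c * cap (Suc L))" if L: "L\<^sub>0 \<le> L" "L < q" for L
  proof -
    \<comment> \<open>Nuclei sharing a cell of scale \<open>L\<close> are within
      \<open>d * L\<close> of each other, hence in the good neighbourhood of any one of them at
      scale \<open>Suc L\<close>.\<close>
    have fibre: "card {v\<in>S L. cell_idx L v = w} \<le> ?c * cap (Suc L)" for w
    proof (cases "{v\<in>S L. cell_idx L v = w} = {}")
      case False
      then obtain u where u: "u \<in> S L" "cell_idx L u = w" by blast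
      have good: "\<And>z. z \<in> nbhd h (cell_idx (Suc L) u) \<Longrightarrow> \<not> bad_cell (Suc L) (cap (Suc L)) X z"
        using u by (auto simp: S_def G_def good_at_def)
      have "{v\<in>S L. cell_idx L v = w} \<subseteq> {v\<in>X. cell_idx (Suc L) v \<in> nbhd h (cell_idx (Suc L) u)}"
      proof clarsimp
        fix v assume v: "v \<in> S L" "w = cell_idx L v"
        have "dist v u \<le> real DIM('a) * real L"
          using v u L L0 by (intro dist_le_same_cell) auto
        also have "\<dots> \<le> real h * real (Suc L)" using h by (intro mult_mono) auto
        finally have "cell_idx (Suc L) v \<in> nbhd h (cell_idx (Suc L) u)"
          by (intro cell_idx_nbhd) auto
        thus "v \<in> X \<and> cell_idx (Suc L) v \<in> nbhd h (cell_idx (Suc L) u)"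
          using v P by (auto simp: S_def)
      qed
      hence "card {v\<in>S L. cell_idx L v = w} \<le> card {v\<in>X. cell_idx (Suc L) v \<in> nbhd h (cell_idx (Suc L) u)}"
        using card_near_le(1)[OF good] by (intro card_mono) auto
      also have "\<dots> \<le> ?c * cap (Suc L)" by (rule card_near_le(2)[OF good])
      finally show ?thesis .
    next
      case True
      thus ?thesis by (metis card.empty le0)
    qed
    have "S L = (\<Union>w\<in>W L. {v\<in>S L. cell_idx L v = w})" by (auto simp: W_def S_def)
    hence "card (S L) \<le> (\<Sum>w\<in>W L. card {v\<in>S L. cell_idx L v = w})"
      using card_UN_le[of "W L" "\<lambda>w. {v\<in>S L. cell_idx L v = w}"] P by (simp add: W_def)
    also have "\<dots> \<le> (\<Sum>w\<in>W L. ?c * cap (Suc L))" by (intro sum_mono fibre)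
    also have "\<dots> \<le> ?c * (b L - 1) * (?c * cap (Suc L))"
      using W[of L] L by (simp only: sum_constant of_nat_id) (intro mult_right_mono, auto)
    finally show ?thesis .
  qed
  \<comment> \<open>A nucleus may lie in several \<open>S L\<close>; counting it in all of them only
    increases the bound and permits exchanging the sums.\<close>
  have "(\<Sum>v\<in>P. real (num_faces X v) powr k) \<le>
      (\<Sum>v\<in>P. g L\<^sub>0 + (\<Sum>L = L\<^sub>0..<q. if v \<in> S L then g (Suc L) else 0))"
  proof (rule sum_mono)
    fix v assume v: "v \<in> P"
    show "real (num_faces X v) powr k \<le> g L\<^sub>0 + (\<Sum>L = L\<^sub>0..<q. if v \<in> S L then g (Suc L) else 0)"
    proof (cases "G L\<^sub>0 v")
      case True
      have "0 \<le> (\<Sum>L = L\<^sub>0..<q. if v \<in> S L then g (Suc L) else 0)" by (intro sum_nonneg) (auto simp: g0)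
      thus ?thesis using faces[OF True L0(1)] by linarith
    next
      case False
      obtain L where L: "L \<in> {L\<^sub>0..<q}" "\<not> G L v" "G (Suc L) v"
        using exists_level_change[of "\<lambda>L. G L v", OF False Gq[OF v] L0(2)] by blast
      have "real (num_faces X v) powr k \<le> g (Suc L)" using L by (intro faces) auto
      also have "\<dots> = (if v \<in> S L then g (Suc L) else 0)" using L v by (simp add: S_def)
      also have "\<dots> \<le> (\<Sum>L = L\<^sub>0..<q. if v \<in> S L then g (Suc L) else 0)"
        using L(1) by (intro member_le_sum) (auto simp: g0)
      also have "\<dots> \<le> g L\<^sub>0 + \<dots>" using g0 by simp
      finally show ?thesis .
    qed
  qed
  also have "\<dots> = real (card P) * g L\<^sub>0 + (\<Sum>L = L\<^sub>0..<q. \<Sum>v\<in>P. if v \<in> S L then g (Suc L) else 0)"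
    by (subst sum.swap) (simp add: sum.distrib)
  also have "(\<Sum>L = L\<^sub>0..<q. \<Sum>v\<in>P. if v \<in> S L then g (Suc L) else 0) =
      (\<Sum>L = L\<^sub>0..<q. real (card (S L)) * g (Suc L))"
  proof (intro sum.cong refl)
    fix L
    have "P \<inter> S L = S L" by (auto simp: S_def)
    thus "(\<Sum>v\<in>P. if v \<in> S L then g (Suc L) else 0) = real (card (S L)) * g (Suc L)"
      using P by (simp add: sum.inter_restrict[symmetric])
  qed
  also have "\<dots> \<le> (\<Sum>L = L\<^sub>0..<q. real (?c * (b L - 1)) * real (?c * cap (Suc L)) * g (Suc L))"
  proof (rule sum_mono)
    fix L assume "L \<in> {L\<^sub>0..<q}"
    hence "real (card (S L)) \<le> real (?c * (b L - 1) * (?c * cap (Suc L)))"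
      using cardS[of L] by (simp only: of_nat_le_iff atLeastLessThan_iff)
    thus "real (card (S L)) * g (Suc L) \<le> real (?c * (b L - 1)) * real (?c * cap (Suc L)) * g (Suc L)"
      by (intro mult_right_mono g0) (simp only: of_nat_mult)
  qed
  finally show ?thesis by simp
qed

text \<open>A visited unit cell inside a good coarse cell lies near the nucleus of a tile touching
  it. The other visited cells lie in bad coarse cells, each consisting of \<open>L ^ d\<close> unit
  cells.\<close>

lemma card_walk_le:
  fixes L :: nat
  assumes L: "0 < L" and no: "\<not> bad_path L (cap L) R (b L) X"
    and vis: "set (cell_idx 1 0 # xs) \<subseteq> cell_idx 1 ` (\<Union>v\<in>P. voronoi_tile X v)"
  shows "card (set (cell_idx 1 0 # xs)) \<le> card P * (2 * (DIM('a) * L) + 1) ^ DIM('a) +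
    L ^ DIM('a) * ((2 * h + 1) ^ DIM('a) * (b L - 1))"
proof -
  let ?S = "set (cell_idx 1 0 # xs)"
  define W where "W = {w \<in> coarse L ` ?S. bad_cell L (cap L) X w}"
  have ext: "?S \<subseteq> extensional Basis" using walk(2) by auto
  have finW: "finite W" by (simp add: W_def)
  have W: "card W \<le> (2 * h + 1) ^ DIM('a) * (b L - 1)"
  proof (rule card_near_bad_le[OF walk L _ _ no R])
    show "\<exists>z\<in>nbhd h w. bad_cell L (cap L) X z" if "w \<in> W" for w
      using that by (intro bexI[of _ w]) (auto simp: W_def mem_nbhd_iff)
  qed (auto simp: W_def)
  have sub: "?S \<subseteq> (\<Union>v\<in>P. nbhd (DIM('a) * L) (cell_idx 1 v)) \<union>
      (\<Union>w\<in>W. {i \<in> extensional Basis. coarse L i = w})" (is "_ \<subseteq> ?A \<union> ?B")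
  proof
    fix i assume i: "i \<in> ?S"
    show "i \<in> ?A \<union> ?B"
    proof (cases "coarse L i \<in> W")
      case True
      thus ?thesis using i ext by blast
    next
      case False
      obtain v x where x: "v \<in> P" "x \<in> voronoi_tile X v" "i = cell_idx 1 x" using i vis by blast
      have "\<not> bad_cell L (cap L) X (cell_idx L x)"
        using False imageI[OF i, of "coarse L"] unfolding W_def x(3) coarse_cell_idx by blast
      hence "dist x v \<le> real DIM('a) * real L" by (rule dist_le_of_not_bad[OF x(2) _ L])
      hence "i \<in> nbhd (DIM('a) * L) (cell_idx 1 v)" unfolding x(3) by (intro cell_idx_nbhd) auto
      thus ?thesis using x by blast
    qed
  qed
  have finA: "finite ?A" using P by auto
  have finB: "finite ?B" using finW card_coarse_fibre(1)[OF L] by auto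
  have "card ?S \<le> card (?A \<union> ?B)" using finA finB sub by (intro card_mono) auto
  also have "\<dots> \<le> card ?A + card ?B" by (rule card_Un_le)
  also have "card ?A \<le> (\<Sum>v\<in>P. card (nbhd (DIM('a) * L) (cell_idx 1 v)))" using P by (intro card_UN_le)
  also have "\<dots> = card P * (2 * (DIM('a) * L) + 1) ^ DIM('a)" by (simp add: card_nbhd)
  also have "card ?B \<le> (\<Sum>w\<in>W. card {i \<in> extensional Basis. coarse L i = w})"
    using finW by (rule card_UN_le)
  also have "\<dots> \<le> (\<Sum>w\<in>W. L ^ DIM('a))" by (intro sum_mono card_coarse_fibre L)
  also have "\<dots> = L ^ DIM('a) * card W" by simp
  also have "\<dots> \<le> L ^ DIM('a) * ((2 * h + 1) ^ DIM('a) * (b L - 1))"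
    using W by (rule mult_left_mono) simp
  finally show ?thesis by simp
qed

end

text \<open>Bad cells are controlled only along walks of bounded length, while the length needed
  depends on the bad cells. So a walk of at most \<open>2 * m\<close> steps is taken first; the
  hypothesis on \<open>m\<close> keeps it from seeing more than \<open>m\<close> cells, hence it
  visits every unit cell met by the polyomino.\<close>

lemma polyomino_award_le:
  fixes X P :: "'a::euclidean_space set" and h m q L\<^sub>0 n :: nat and cap b :: "nat \<Rightarrow> nat" and k R :: real
  defines "c \<equiv> (2 * h + 1) ^ DIM('a)"
  assumes h: "2 * DIM('a) + 2 \<le> h" and L0: "0 < L\<^sub>0" "L\<^sub>0 \<le> q" and k: "0 \<le> k"
    and P: "P \<in> polyominoes X n"
    and R: "real (DIM('a) * (2 * h + 1) * (2 * m + 1)) \<le> R"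
    and no: "\<And>L. L\<^sub>0 \<le> L \<Longrightarrow> L \<le> q \<Longrightarrow> \<not> bad_path L (cap L) R (b L) X"
    and bq: "b q = 1"
    and m: "n * (2 * (DIM('a) * L\<^sub>0) + 1) ^ DIM('a) + L\<^sub>0 ^ DIM('a) * (c * (b L\<^sub>0 - 1)) \<le> m"
  shows "(\<Sum>v\<in>P. real (num_faces X v) powr k) \<le> real n * real (c * cap L\<^sub>0) powr k +
    (\<Sum>L = L\<^sub>0..<q. real (c * (b L - 1)) * real (c * cap (Suc L)) * real (c * cap (Suc L)) powr k)"
proof -
  define U where "U = (\<Union>v\<in>P. voronoi_tile X v)"
  have P': "P \<subseteq> X" "finite P" "card P = n" "connected U" "0 \<in> U"
    using P by (auto simp: polyominoes_def U_def)
  obtain xs where xs: "successively (\<lambda>i j. i \<in> nbhd 1 j) (cell_idx 1 0 # xs)"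
    "set xs \<subseteq> cell_idx 1 ` U" "length xs \<le> 2 * m"
    "m < card (set (cell_idx 1 0 # xs)) \<or> set (cell_idx 1 0 # xs) = cell_idx 1 ` U"
    using exists_cell_walk[OF P'(4,5)] by blast
  have ext: "set xs \<subseteq> extensional Basis" using xs(2) by auto
  have sub: "set (cell_idx 1 0 # xs) \<subseteq> cell_idx 1 ` U" using xs(2) P'(5) by auto
  have "DIM('a) * (2 * h + 1) * (length xs + 1) \<le> DIM('a) * (2 * h + 1) * (2 * m + 1)"
    using xs(3) by (intro mult_le_mono) auto
  hence R': "real (DIM('a) * (2 * h + 1) * (length xs + 1)) \<le> R"
    using R by (meson of_nat_mono order_trans)
  have "card (set (cell_idx 1 0 # xs)) \<le> m"
    using card_walk_le[where cap = cap and b = b, OF h P'(1,2) xs(1) ext R' L0(1)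
        no[OF order_refl L0(2)] sub[unfolded U_def]] m
    unfolding c_def P'(3) by (rule order_trans)
  hence eq: "set (cell_idx 1 0 # xs) = cell_idx 1 ` U" using xs(4) by linarith
  have "P \<subseteq> U" by (auto simp: U_def voronoi_tile_def)
  hence vis: "cell_idx 1 ` P \<subseteq> set (cell_idx 1 0 # xs)" unfolding eq by blast
  show ?thesis
    using sum_faces_le[where cap = cap and b = b, OF h P'(1,2) xs(1) ext R' L0 k no bq vis] P'(3) unfolding c_def by simp
qed

subsection \<open>Probabilities of bad cells and bad paths\<close>

text \<open>On each side of \<open>c\<close> the distances are distinct, so each half is dominated
  by the geometric series of ratio \<open>exp (- \<theta>)\<close>, whose sum is at most
  \<open>2 / \<theta>\<close> for \<open>\<theta> \<le> 1\<close>.\<close>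

lemma sum_exp_abs_int_le:
  fixes \<theta> :: real and F :: "int set"
  assumes \<theta>: "0 < \<theta>" "\<theta> \<le> 1" and F: "finite F"
  shows "(\<Sum>j\<in>F. exp (- \<theta> * \<bar>real_of_int (c - j)\<bar>)) \<le> 4 / \<theta>"
proof -
  define r where "r = exp (- \<theta>)"
  have r: "0 < r" "r < 1" using \<theta> by (auto simp: r_def)
  have "r \<le> 1 / (1 + \<theta>)"
    using exp_ge_add_one_self[of \<theta>] \<theta> unfolding r_def exp_minus
    by (simp add: field_simps)
  moreover have "\<theta> / 2 \<le> \<theta> / (1 + \<theta>)" using \<theta> by (intro divide_left_mono) auto
  moreover have "\<theta> / (1 + \<theta>) = 1 - 1 / (1 + \<theta>)" using \<theta> by (simp add: field_simps)
  ultimately have "1 - r \<ge> \<theta> / 2" by linarith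
  hence r2: "1 / (1 - r) \<le> 2 / \<theta>" using \<theta> r by (simp add: field_simps)
  have half: "(\<Sum>j\<in>S. exp (- \<theta> * \<bar>real_of_int (c - j)\<bar>)) \<le> 2 / \<theta>"
    if S: "finite S" and inj: "inj_on (\<lambda>j. nat \<bar>c - j\<bar>) S" for S
  proof -
    have "(\<Sum>j\<in>S. exp (- \<theta> * \<bar>real_of_int (c - j)\<bar>)) = (\<Sum>j\<in>S. r ^ nat \<bar>c - j\<bar>)"
      by (intro sum.cong) (auto simp: r_def exp_of_nat_mult[symmetric] mult.commute)
    also have "\<dots> = (\<Sum>i\<in>(\<lambda>j. nat \<bar>c - j\<bar>) ` S. r ^ i)" by (simp add: sum.reindex[OF inj])
    also have "\<dots> \<le> (\<Sum>i. r ^ i)"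
      using r S by (intro sum_le_suminf summable_geometric) auto
    also have "\<dots> = 1 / (1 - r)" using r by (intro suminf_geometric) auto
    finally show ?thesis using r2 by linarith
  qed
  have "(\<Sum>j\<in>F. exp (- \<theta> * \<bar>real_of_int (c - j)\<bar>)) =
      (\<Sum>j\<in>F \<inter> {c..}. exp (- \<theta> * \<bar>real_of_int (c - j)\<bar>)) +
      (\<Sum>j\<in>F - {c..}. exp (- \<theta> * \<bar>real_of_int (c - j)\<bar>))"
    by (rule sum.Int_Diff[OF F])
  also have "\<dots> \<le> 2 / \<theta> + 2 / \<theta>"
    using F by (intro add_mono half) (auto simp: inj_on_def)
  finally show ?thesis by simp
qed

text \<open>A product of one-dimensional sums. The bound is uniform in \<open>a\<close>, as the
  summation over paths requires, and in the size \<open>Q\<close> of the box.\<close>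

lemma sum_exp_idx_dist_le:
  fixes \<theta> :: real and a :: "'a::euclidean_space \<Rightarrow> int"
  assumes \<theta>: "0 < \<theta>" "\<theta> \<le> 1"
  shows "(\<Sum>y\<in>Basis \<rightarrow>\<^sub>E {-Q..Q}. exp (- \<theta> * idx_dist a y)) \<le> (4 / \<theta>) ^ DIM('a)"
proof -
  have "(\<Sum>y\<in>Basis \<rightarrow>\<^sub>E {-Q..Q}. exp (- \<theta> * idx_dist a y)) =
      (\<Sum>y\<in>Basis \<rightarrow>\<^sub>E {-Q..Q}. \<Prod>b\<in>Basis. exp (- \<theta> * \<bar>real_of_int (a b - y b)\<bar>))"
    by (simp add: idx_dist_def exp_sum sum_distrib_left sum_negf[symmetric])
  also have "\<dots> = (\<Prod>b\<in>Basis. \<Sum>j\<in>{-Q..Q}. exp (- \<theta> * \<bar>real_of_int (a b - j)\<bar>))"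
    by (rule prod_sum_PiE[symmetric]) auto
  also have "\<dots> \<le> (\<Prod>b\<in>(Basis::'a set). 4 / \<theta>)"
    by (intro prod_mono conjI sum_nonneg sum_exp_abs_int_le \<theta>) auto
  finally show ?thesis by simp
qed

text \<open>The continuations after the first vertex \<open>y\<close> are summed first, with a bound
  that does not depend on \<open>y\<close>.\<close>

lemma sum_exp_path_length_le:
  assumes "\<And>a. (\<Sum>y\<in>I. exp (- \<theta> * idx_dist a y)) \<le> C" "finite I"
  shows "(\<Sum>ys | set ys \<subseteq> I \<and> length ys = b. exp (- \<theta> * path_length a ys)) \<le> C ^ b"
proof (induction b arbitrary: a)
  case 0
  have "{ys. set ys \<subseteq> I \<and> length ys = 0} = {[]}" by auto
  thus ?case by simp
next
  case (Suc b)
  let ?T = "{ys. set ys \<subseteq> I \<and> length ys = b}"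
  have "0 \<le> (\<Sum>y\<in>I. exp (- \<theta> * idx_dist a y))" by (intro sum_nonneg) auto
  hence C: "0 \<le> C" using assms(1)[of a] by linarith
  have "(\<Sum>ys | set ys \<subseteq> I \<and> length ys = Suc b. exp (- \<theta> * path_length a ys)) =
      (\<Sum>(ys, y)\<in>?T \<times> I. exp (- \<theta> * path_length a (y # ys)))"
    unfolding lists_length_Suc_eq by (subst sum.reindex) (auto simp: inj_on_def case_prod_unfold)
  also have "\<dots> = (\<Sum>ys\<in>?T. \<Sum>y\<in>I. exp (- \<theta> * path_length a (y # ys)))"
    by (rule sum.cartesian_product[symmetric])
  also have "\<dots> = (\<Sum>y\<in>I. \<Sum>ys\<in>?T. exp (- \<theta> * path_length a (y # ys)))"
    by (rule sum.swap)
  also have "\<dots> = (\<Sum>y\<in>I. exp (- \<theta> * idx_dist a y) * (\<Sum>ys\<in>?T. exp (- \<theta> * path_length y ys)))"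
    by (simp add: sum_distrib_left exp_add[symmetric] algebra_simps)
  also have "\<dots> \<le> (\<Sum>y\<in>I. exp (- \<theta> * idx_dist a y) * C ^ b)"
    by (intro sum_mono mult_left_mono Suc.IH) auto
  also have "\<dots> = (\<Sum>y\<in>I. exp (- \<theta> * idx_dist a y)) * C ^ b" by (simp add: sum_distrib_right)
  also have "\<dots> \<le> C * C ^ b" using C by (intro mult_right_mono assms) auto
  finally show ?case by simp
qed

section \<open>Volume of a cell and the tail of the Poisson law\<close>

lemma cell_eq:
  fixes y :: "'a::euclidean_space \<Rightarrow> int"
  assumes "y \<in> extensional Basis" "L > 0"
  shows "cell L y = {x. \<forall>b\<in>Basis. real L * y b \<le> x \<bullet> b \<and> x \<bullet> b < real L * (y b + 1)}"
proof -
  have "cell_idx L x = y \<longleftrightarrow> (\<forall>b\<in>Basis. real L * y b \<le> x \<bullet> b \<and> x \<bullet> b < real L * (y b + 1))" for x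
  proof -
    have "cell_idx L x = y \<longleftrightarrow> (\<forall>b\<in>Basis. \<lfloor>(x \<bullet> b) / real L\<rfloor> = y b)"
      using assms(1) unfolding cell_idx_def by (auto simp: fun_eq_iff extensional_def restrict_def)
    also have "\<dots> \<longleftrightarrow> (\<forall>b\<in>Basis. real L * y b \<le> x \<bullet> b \<and> x \<bullet> b < real L * (y b + 1))"
      using assms(2) by (intro ball_cong refl) (simp add: floor_eq_iff field_simps)
    finally show ?thesis .
  qed
  thus ?thesis by (simp add: cell_def)
qed

lemma sets_borel_cell:
  fixes y :: "'a::euclidean_space \<Rightarrow> int"
  assumes "y \<in> extensional Basis" "L > 0"
  shows "cell L y \<in> sets borel"
  unfolding cell_eq[OF assms] by measurable

lemma emeasure_lebesgue_cell:
  fixes y :: "'a::euclidean_space \<Rightarrow> int"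
  assumes "y \<in> extensional Basis" "L > 0"
  shows "emeasure lebesgue (cell L y) = ennreal (real L ^ DIM('a))"
proof -
  define l where "l = (\<Sum>b\<in>Basis. (real L * y b) *\<^sub>R b)"
  define u where "u = (\<Sum>b\<in>Basis. (real L * (y b + 1)) *\<^sub>R b)"
  have lu: "l \<bullet> b = real L * y b" "u \<bullet> b = real L * (y b + 1)" if "b \<in> Basis" for b
    using that by (auto simp: l_def u_def)
  have le: "l \<bullet> b \<le> u \<bullet> b" if "b \<in> Basis" for b
    using lu[OF that] by (simp add: algebra_simps)
  have "(\<Prod>b\<in>Basis. (u - l) \<bullet> b) = (\<Prod>b\<in>(Basis::'a set). real L)"
    by (intro prod.cong refl) (simp add: lu inner_diff_left algebra_simps)
  hence pr: "(\<Prod>b\<in>Basis. (u - l) \<bullet> b) = real L ^ DIM('a)" by simp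
  have borel: "cell L y \<in> sets lborel" using sets_borel_cell[OF assms] by simp
  have "emeasure lborel (cell L y) \<le> emeasure lborel (cbox l u)"
    by (intro emeasure_mono subsetI) (auto simp: cell_eq[OF assms] mem_box lu less_imp_le)
  moreover have "emeasure lborel (box l u) \<le> emeasure lborel (cell L y)"
    using borel by (intro emeasure_mono) (auto simp: cell_eq[OF assms] mem_box lu less_imp_le)
  ultimately have "emeasure lborel (cell L y) = ennreal (real L ^ DIM('a))"
    using le by (simp add: emeasure_lborel_box emeasure_lborel_cbox pr)
  thus ?thesis using borel by simp
qed

text \<open>Chernoff bound: for \<open>j > m\<close> the factor \<open>exp (j - m)\<close> is at
  least 1, and inserting it turns the tail into a part of the series of
  \<open>exp (exp 1 * \<Lambda>)\<close>. Finally \<open>exp 1 - 1 \<le> 2\<close>.\<close>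

lemma poisson_tail_le:
  fixes \<Lambda> :: real
  assumes "0 \<le> \<Lambda>"
  shows "1 - (\<Sum>j\<le>m. exp (- \<Lambda>) * \<Lambda> ^ j / fact j) \<le> exp (2 * \<Lambda> - real m)"
proof -
  define f where "f x = (\<lambda>j. x ^ j / fact j)" for x :: real
  have f: "f x sums exp x" for x
    using exp_converges[of x] by (simp add: f_def field_simps)
  have "(\<lambda>j. if j \<in> {..m} then f \<Lambda> j else 0) sums (\<Sum>j\<le>m. f \<Lambda> j)"
    by (rule sums_If_finite_set) simp
  hence rhs: "(\<lambda>j. (if j \<in> {..m} then f \<Lambda> j else 0) + exp (- real m) * f (exp 1 * \<Lambda>) j)
      sums ((\<Sum>j\<le>m. f \<Lambda> j) + exp (- real m) * exp (exp 1 * \<Lambda>))"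
    by (intro sums_add sums_mult f)
  have "exp \<Lambda> \<le> (\<Sum>j\<le>m. f \<Lambda> j) + exp (- real m) * exp (exp 1 * \<Lambda>)"
  proof (rule sums_le[OF _ f rhs])
    fix j
    show "f \<Lambda> j \<le> (if j \<in> {..m} then f \<Lambda> j else 0) + exp (- real m) * f (exp 1 * \<Lambda>) j"
    proof (cases "j \<le> m")
      case True
      have "0 \<le> f (exp 1 * \<Lambda>) j" using assms by (simp add: f_def)
      thus ?thesis using True by simp
    next
      case False
      have "f (exp 1 * \<Lambda>) j = exp (real j) * f \<Lambda> j"
        by (simp add: f_def power_mult_distrib exp_of_nat_mult[symmetric])
      hence "exp (- real m) * f (exp 1 * \<Lambda>) j = exp (real j - real m) * f \<Lambda> j"
        by (simp add: exp_diff exp_minus field_simps)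
      moreover have "1 * f \<Lambda> j \<le> exp (real j - real m) * f \<Lambda> j"
        using False assms by (intro mult_right_mono) (auto simp: f_def)
      ultimately show ?thesis using False by simp
    qed
  qed
  hence "exp (- \<Lambda>) * exp \<Lambda> \<le>
      exp (- \<Lambda>) * ((\<Sum>j\<le>m. f \<Lambda> j) + exp (- real m) * exp (exp 1 * \<Lambda>))"
    by (rule mult_left_mono) simp
  also have "\<dots> = (\<Sum>j\<le>m. exp (- \<Lambda>) * \<Lambda> ^ j / fact j) + exp (- \<Lambda> - real m + exp 1 * \<Lambda>)"
    by (simp add: f_def sum_distrib_left distrib_left exp_add exp_diff exp_minus field_simps)
  also have "exp (- \<Lambda> - real m + exp 1 * \<Lambda>) \<le> exp (2 * \<Lambda> - real m)"
    using mult_right_mono[OF exp_le assms] by simp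
  finally show ?thesis by (simp add: exp_minus)
qed

section \<open>Bad cells and bad paths of a Poisson set\<close>

locale poisson_set = prob_space M for M :: "'w measure" +
  fixes \<mu> :: "'a::euclidean_space measure" and N :: "'w \<Rightarrow> 'a set"
  assumes comparable: "comparable_to_lebesgue \<mu>"
    and poisson: "poisson_random_set M \<mu> N"
begin

lemma count_measurable: "A \<in> sets borel \<Longrightarrow> (\<lambda>\<omega>. point_count A (N \<omega>)) \<in> borel_measurable M"
  using poisson by (simp add: poisson_random_set_def)

lemma sets_bad_cell [measurable]:
  assumes "y \<in> extensional Basis" "L > 0"
  shows "{\<omega>\<in>space M. bad_cell L cap (N \<omega>) y} \<in> sets M"
proof -
  note [measurable] = count_measurable[OF sets_borel_cell[OF assms]]
  show ?thesis unfolding bad_cell_def by measurable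
qed

text \<open>With \<open>V = L ^ d\<close>, comparability puts the mean count between
  \<open>V / c\<close> and \<open>c * V\<close>. The lower bound makes emptiness unlikely, the upper
  bound together with the Poisson tail makes overcrowding unlikely.\<close>

lemma prob_bad_cell_le:
  "\<exists>\<alpha>>0. \<exists>C\<^sub>0::nat. \<forall>L>0. \<forall>y\<in>extensional Basis.
     prob {\<omega>\<in>space M. bad_cell L (C\<^sub>0 * L ^ DIM('a)) (N \<omega>) y} \<le> 2 * exp (- \<alpha> * real L ^ DIM('a))"
proof -
  obtain c :: real where c: "0 < c" "\<And>A. A \<in> sets lebesgue \<Longrightarrow>
      ennreal (1 / c) * emeasure lebesgue A \<le> emeasure \<mu> A \<and>
      emeasure \<mu> A \<le> ennreal c * emeasure lebesgue A"
    using comparable unfolding comparable_to_lebesgue_def by blast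
  \<comment> \<open>Makes \<open>2 * \<Lambda> - cap \<le> - V / c\<close> even for the largest mean
    \<open>c * V\<close>, so that both kinds of badness get the same exponent.\<close>
  define C\<^sub>0 where "C\<^sub>0 = nat \<lceil>2 * c + 1 / c\<rceil>"
  have C0: "2 * c + 1 / c \<le> real C\<^sub>0" unfolding C\<^sub>0_def by (rule real_nat_ceiling_ge)
  have "prob {\<omega>\<in>space M. bad_cell L (C\<^sub>0 * L ^ DIM('a)) (N \<omega>) y} \<le> 2 * exp (- (1 / c) * real L ^ DIM('a))"
    if L: "L > 0" and y: "y \<in> extensional Basis" for L and y :: "'a \<Rightarrow> int"
  proof -
    define A where "A = cell L y"
    define V where "V = real L ^ DIM('a)"
    define cap where "cap = C\<^sub>0 * L ^ DIM('a)"
    define \<Lambda> where "\<Lambda> = measure \<mu> A"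
    have V: "0 \<le> V" by (simp add: V_def)
    have A: "A \<in> sets borel" unfolding A_def by (rule sets_borel_cell[OF y L])
    have leb: "emeasure lebesgue A = ennreal V"
      unfolding A_def V_def by (rule emeasure_lebesgue_cell[OF y L])
    have "A \<in> sets lebesgue" using A by simp
    from c(2)[OF this] have bnd: "ennreal (V / c) \<le> emeasure \<mu> A" "emeasure \<mu> A \<le> ennreal (c * V)"
      unfolding leb using c(1) V by (auto simp: ennreal_mult[symmetric] field_simps)
    have fin: "emeasure \<mu> A < \<infinity>" using bnd(2) by (metis ennreal_less_top infinity_ennreal_def le_less_trans)
    have em: "emeasure \<mu> A = ennreal \<Lambda>"
      unfolding \<Lambda>_def using fin by (intro emeasure_eq_ennreal_measure) auto
    have \<Lambda>0: "0 \<le> \<Lambda>" by (simp add: \<Lambda>_def)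
    have \<Lambda>: "V / c \<le> \<Lambda>" "\<Lambda> \<le> c * V"
      using bnd \<Lambda>0 c(1) V unfolding em by (auto simp: ennreal_le_iff)
    have pois: "prob {\<omega>\<in>space M. point_count A (N \<omega>) = of_nat m} = exp (- \<Lambda>) * \<Lambda> ^ m / fact m" for m
      using poisson A fin unfolding poisson_random_set_def \<Lambda>_def by blast
    note [measurable] = count_measurable[OF A]
    have "prob {\<omega>\<in>space M. \<exists>m\<le>cap. point_count A (N \<omega>) = of_nat m} =
        prob (\<Union>m\<in>{..cap}. {\<omega>\<in>space M. point_count A (N \<omega>) = of_nat m})"
      by (intro arg_cong[where f = prob]) auto
    also have "\<dots> = (\<Sum>m\<le>cap. exp (- \<Lambda>) * \<Lambda> ^ m / fact m)"
      by (subst finite_measure_finite_Union) (auto simp: pois disjoint_family_on_def)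
    finally have le_cap: "prob {\<omega>\<in>space M. \<exists>m\<le>cap. point_count A (N \<omega>) = of_nat m} =
        (\<Sum>m\<le>cap. exp (- \<Lambda>) * \<Lambda> ^ m / fact m)" .
    \<comment> \<open>Overcrowding is the complement of finitely many Poisson events, which includes
      infinite counts.\<close>
    have "prob {\<omega>\<in>space M. \<not> (\<exists>m\<le>cap. point_count A (N \<omega>) = of_nat m)} \<le> exp (2 * \<Lambda> - real cap)"
      using poisson_tail_le[OF \<Lambda>0, of cap] unfolding le_cap[symmetric] by (subst prob_neg) auto
    also have "\<dots> \<le> exp (- (1 / c) * V)"
    proof -
      have "(2 * c + 1 / c) * V \<le> real C\<^sub>0 * V" by (rule mult_right_mono[OF C0 V])
      thus ?thesis using \<Lambda>(2) by (simp add: cap_def V_def algebra_simps)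
    qed
    finally have p1: "prob {\<omega>\<in>space M. \<not> (\<exists>m\<le>cap. point_count A (N \<omega>) = of_nat m)} \<le> exp (- (1 / c) * V)" .
    have p2: "prob {\<omega>\<in>space M. point_count A (N \<omega>) = 0} \<le> exp (- (1 / c) * V)"
      using pois[of 0] \<Lambda>(1) by simp
    have m: "{\<omega>\<in>space M. point_count A (N \<omega>) = 0} \<in> sets M"
      "{\<omega>\<in>space M. \<not> (\<exists>m\<le>cap. point_count A (N \<omega>) = of_nat m)} \<in> sets M"
      by measurable
    have "prob {\<omega>\<in>space M. bad_cell L cap (N \<omega>) y} \<le>
        prob ({\<omega>\<in>space M. point_count A (N \<omega>) = 0} \<union>
          {\<omega>\<in>space M. \<not> (\<exists>m\<le>cap. point_count A (N \<omega>) = of_nat m)})"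
    proof (rule finite_measure_mono)
      have "of_nat m \<le> (of_nat cap :: ennreal)" if "m \<le> cap" for m using that by simp
      thus "{\<omega>\<in>space M. bad_cell L cap (N \<omega>) y} \<subseteq> {\<omega>\<in>space M. point_count A (N \<omega>) = 0} \<union>
          {\<omega>\<in>space M. \<not> (\<exists>m\<le>cap. point_count A (N \<omega>) = of_nat m)}"
        by (auto simp: bad_cell_def A_def not_less[symmetric])
    qed (use m in blast)
    also have "\<dots> \<le> exp (- (1 / c) * V) + exp (- (1 / c) * V)"
      using p1 p2 measure_Un_le[OF m] by linarith
    finally show ?thesis by (simp add: cap_def V_def)
  qed
  thus ?thesis using c(1) by (intro exI[of _ "1 / c"] conjI exI[of _ C\<^sub>0]) auto
qed

lemma prob_all_bad_le:
  fixes ys :: "('a \<Rightarrow> int) list"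
  assumes L: "L > 0" and ys: "distinct ys" "set ys \<subseteq> extensional Basis"
    and p: "\<And>y. y \<in> extensional Basis \<Longrightarrow> prob {\<omega>\<in>space M. bad_cell L cap (N \<omega>) y} \<le> p"
  shows "prob {\<omega>\<in>space M. \<forall>y\<in>set ys. bad_cell L cap (N \<omega>) y} \<le> p ^ length ys"
proof (cases "ys = []")
  case False
  \<comment> \<open>Independence is available for sequences of disjoint sets, so the cells are
    continued by empty sets.\<close>
  define A where "A i = (if i < length ys then cell L (ys ! i) else {})" for i
  define S where "S = {0} \<union> {of_nat cap<..} \<inter> (UNIV :: ennreal set)"
  define X where "X i \<omega> = point_count (A i) (N \<omega>)" for i \<omega>
  have ext: "ys ! i \<in> extensional Basis" if "i < length ys" for i using ys that by (meson nth_mem subsetD)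
  have "range A \<subseteq> sets borel" using sets_borel_cell[OF ext L] by (auto simp: A_def)
  moreover have "disjoint_family A"
    using ys(1) by (auto simp: disjoint_family_on_def A_def cell_def nth_eq_iff_index_eq)
  ultimately have indep: "indep_vars (\<lambda>_. borel) X UNIV"
    using poisson unfolding poisson_random_set_def X_def by blast
  have ev: "X i -` S \<inter> space M = {\<omega>\<in>space M. bad_cell L cap (N \<omega>) (ys ! i)}" if "i < length ys" for i
    using that by (auto simp: X_def S_def A_def bad_cell_def)
  have "{\<omega>\<in>space M. \<forall>y\<in>set ys. bad_cell L cap (N \<omega>) y} =
      (\<Inter>i\<in>{..<length ys}. {\<omega>\<in>space M. bad_cell L cap (N \<omega>) (ys ! i)})"
    using False by (auto simp: set_conv_nth)
  also have "\<dots> = (\<Inter>i\<in>{..<length ys}. X i -` S \<inter> space M)" using ev by simp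
  finally have "prob {\<omega>\<in>space M. \<forall>y\<in>set ys. bad_cell L cap (N \<omega>) y} =
      (\<Prod>i<length ys. prob (X i -` S \<inter> space M))"
    using False by (simp only:) (subst indep_varsD[OF indep], auto simp: S_def)
  also have "\<dots> \<le> (\<Prod>i<length ys. p)" using p ext ev by (intro prod_mono) auto
  finally show ?thesis by simp
qed simp

text \<open>Union bound over the finitely many tuples of distinct cells with path length at most
  \<open>R\<close>, each of which is entirely bad with probability at most
  \<open>p ^ b\<close>.\<close>

lemma
  fixes \<theta> R p :: real and b L :: nat
  assumes L: "L > 0" and \<theta>: "0 < \<theta>" "\<theta> \<le> 1" and p0: "0 \<le> p"
    and p: "\<And>y. y \<in> extensional Basis \<Longrightarrow> prob {\<omega>\<in>space M. bad_cell L cap (N \<omega>) y} \<le> p"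
  shows sets_bad_path: "{\<omega>\<in>space M. bad_path L cap R b (N \<omega>)} \<in> sets M"
    and prob_bad_path_le: "prob {\<omega>\<in>space M. bad_path L cap R b (N \<omega>)} \<le>
      exp (\<theta> * R) * ((4 / \<theta>) ^ DIM('a) * p) ^ b"
proof -
  \<comment> \<open>This box contains every vertex of a path of length at most \<open>R\<close> from
    the zero index.\<close>
  define I where "I = (Basis::'a set) \<rightarrow>\<^sub>E {-\<lceil>R\<rceil>..\<lceil>R\<rceil>}"
  define T where "T = {ys. set ys \<subseteq> I \<and> length ys = b}"
  define T' where "T' = {ys\<in>T. distinct ys \<and> path_length (cell_idx L 0) ys \<le> R}"
  define B where "B ys = {\<omega>\<in>space M. \<forall>y\<in>set ys. bad_cell L cap (N \<omega>) y}" for ys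
  have finI: "finite I" unfolding I_def by (intro finite_PiE) auto
  have finT: "finite T" unfolding T_def by (intro finite_lists_length_eq finI)
  hence finT': "finite T'" unfolding T'_def by simp
  have ext: "set ys \<subseteq> extensional Basis" if "ys \<in> T" for ys
    using that by (auto simp: T_def I_def PiE_iff)
  have B: "B ys \<in> sets M" if "ys \<in> T'" for ys
  proof -
    have "{\<omega>\<in>space M. bad_cell L cap (N \<omega>) y} \<in> sets M" if "y \<in> set ys" for y
      using that ext[of ys] \<open>ys \<in> T'\<close> L by (intro sets_bad_cell) (auto simp: T'_def)
    thus ?thesis unfolding B_def by (intro sets.sets_Collect_finite_All) auto
  qed
  have in_I: "set ys \<subseteq> I"
    if "path_length (cell_idx L 0) ys \<le> R" "set ys \<subseteq> extensional Basis" for ys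
  proof
    fix y assume y: "y \<in> set ys"
    have "\<bar>y b\<bar> \<le> \<lceil>R\<rceil>" if b: "b \<in> Basis" for b
    proof -
      have "\<bar>real_of_int (cell_idx L 0 b - y b)\<bar> \<le> idx_dist (cell_idx L 0) y"
        unfolding idx_dist_def using b by (intro member_le_sum) auto
      also have "\<dots> \<le> R" using idx_dist_mem_le[OF y] \<open>path_length _ ys \<le> R\<close> by (rule order_trans)
      finally have "\<bar>real_of_int (y b)\<bar> \<le> R" using b by (simp add: cell_idx_def)
      thus ?thesis by linarith
    qed
    thus "y \<in> I" using y that(2) by (fastforce simp: I_def PiE_iff)
  qed
  have eq: "{\<omega>\<in>space M. bad_path L cap R b (N \<omega>)} = (\<Union>ys\<in>T'. B ys)"
  proof
    show "{\<omega>\<in>space M. bad_path L cap R b (N \<omega>)} \<subseteq> (\<Union>ys\<in>T'. B ys)"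
      using in_I by (fastforce simp: bad_path_def T'_def T_def B_def)
    show "(\<Union>ys\<in>T'. B ys) \<subseteq> {\<omega>\<in>space M. bad_path L cap R b (N \<omega>)}"
      using ext by (fastforce simp: bad_path_def T'_def T_def B_def)
  qed
  show "{\<omega>\<in>space M. bad_path L cap R b (N \<omega>)} \<in> sets M"
    unfolding eq using B finT' by blast
  have "prob {\<omega>\<in>space M. bad_path L cap R b (N \<omega>)} \<le> (\<Sum>ys\<in>T'. prob (B ys))"
    unfolding eq using B finT' by (intro finite_measure_subadditive_finite) auto
  also have "\<dots> \<le> (\<Sum>ys\<in>T'. p ^ b)"
  proof (rule sum_mono)
    fix ys assume "ys \<in> T'"
    thus "prob (B ys) \<le> p ^ b"
      using prob_all_bad_le[OF L _ _ p, of ys] ext[of ys] by (auto simp: T'_def T_def B_def)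
  qed
  \<comment> \<open>The inserted factor is at least 1 on \<open>T'\<close>. It allows dropping the
    constraints on length and distinctness with a bound that does not depend on the box
    \<open>I\<close>.\<close>
  also have "\<dots> \<le> (\<Sum>ys\<in>T'. (exp (\<theta> * R) * exp (- \<theta> * path_length (cell_idx L 0) ys)) * p ^ b)"
  proof (rule sum_mono)
    fix ys assume "ys \<in> T'"
    hence "0 \<le> \<theta> * (R - path_length (cell_idx L 0) ys)" using \<theta> by (auto simp: T'_def)
    hence "1 \<le> exp (\<theta> * R) * exp (- \<theta> * path_length (cell_idx L 0) ys)"
      by (simp add: exp_add[symmetric] algebra_simps)
    from mult_right_mono[OF this, of "p ^ b"] p0
    show "p ^ b \<le> (exp (\<theta> * R) * exp (- \<theta> * path_length (cell_idx L 0) ys)) * p ^ b" by simp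
  qed
  also have "\<dots> = exp (\<theta> * R) * p ^ b * (\<Sum>ys\<in>T'. exp (- \<theta> * path_length (cell_idx L 0) ys))"
    by (simp add: sum_distrib_left mult_ac)
  also have "\<dots> \<le> exp (\<theta> * R) * p ^ b * ((4 / \<theta>) ^ DIM('a)) ^ b"
  proof (rule mult_left_mono)
    have "(\<Sum>ys\<in>T'. exp (- \<theta> * path_length (cell_idx L 0) ys)) \<le>
        (\<Sum>ys\<in>T. exp (- \<theta> * path_length (cell_idx L 0) ys))"
      using finT by (intro sum_mono2) (auto simp: T'_def)
    also have "\<dots> \<le> ((4 / \<theta>) ^ DIM('a)) ^ b"
      unfolding T_def by (intro sum_exp_path_length_le finI)
        (unfold I_def, rule sum_exp_idx_dist_le[OF \<theta>])
    finally show "(\<Sum>ys\<in>T'. exp (- \<theta> * path_length (cell_idx L 0) ys)) \<le> ((4 / \<theta>) ^ DIM('a)) ^ b" .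
  qed (use p0 in auto)
  also have "\<dots> = exp (\<theta> * R) * ((4 / \<theta>) ^ DIM('a) * p) ^ b"
    by (simp only: power_mult_distrib mult_ac)
  finally show "prob {\<omega>\<in>space M. bad_path L cap R b (N \<omega>)} \<le>
      exp (\<theta> * R) * ((4 / \<theta>) ^ DIM('a) * p) ^ b" .
qed

end

subsection \<open>Choice of the scales\<close>

lemma self_le_power_DIM: "real L \<le> real L ^ DIM('a::euclidean_space)"
proof (cases "L = 0")
  case False
  thus ?thesis using power_increasing[of 1 "DIM('a)" "real L"] DIM_positive[where 'a='a]
    by (simp add: Suc_le_eq)
qed simp

lemma summable_exp_powr:
  fixes \<gamma> k :: real and u d :: nat
  assumes \<gamma>: "0 < \<gamma>" and d: "1 \<le> d" and k: "0 \<le> k"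
  shows "summable (\<lambda>L. exp (- \<gamma> * real L ^ d) * real (u * Suc L ^ d) powr k)"
proof (rule summable_comparison_test_ev)
  define e where "e = real d * k"
  define w where "w = real u powr k"
  have "eventually (\<lambda>L::nat. exp (- \<gamma> * real L) * (real L + 1) powr e \<le> 1 / real L ^ 2) at_top"
    using \<gamma> by real_asymp
  moreover have "eventually (\<lambda>L::nat. L \<ge> 1) at_top" by (rule eventually_ge_at_top)
  ultimately show "eventually (\<lambda>L. norm (exp (- \<gamma> * real L ^ d) * real (u * Suc L ^ d) powr k) \<le>
      w * inverse (real L ^ 2)) at_top"
  proof eventually_elim
    case (elim L)
    have "real L \<le> real L ^ d" using power_increasing[OF d, of "real L"] elim by simp
    hence le: "exp (- \<gamma> * real L ^ d) \<le> exp (- \<gamma> * real L)" using \<gamma> by simp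
    have eq: "real (u * Suc L ^ d) powr k = w * (real L + 1) powr e"
      by (simp add: w_def e_def powr_mult powr_powr[symmetric] powr_realpow[symmetric] add.commute)
    have "exp (- \<gamma> * real L ^ d) * real (u * Suc L ^ d) powr k \<le>
        exp (- \<gamma> * real L) * (w * (real L + 1) powr e)"
      unfolding eq using le by (intro mult_right_mono) (auto simp: w_def)
    also have "\<dots> = w * (exp (- \<gamma> * real L) * (real L + 1) powr e)" by simp
    also have "\<dots> \<le> w * (1 / real L ^ 2)" using elim(1) by (intro mult_left_mono) (auto simp: w_def)
    finally show ?case by (simp add: inverse_eq_divide)
  qed
  show "summable (\<lambda>L. w * inverse (real L ^ 2))"
    by (intro summable_mult inverse_power_summable) simp
qed

context poisson_set
begin

text \<open>Taking \<open>\<theta>\<close> exponentially small in the volume of a cell makes the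
  length \<open>R\<close> nearly irrelevant at large scales, while each bad cell still costs a
  factor exponential in its volume.\<close>

lemma prob_bad_path_le_exp:
  "\<exists>\<beta>>0. \<exists>\<gamma>>0. \<exists>C\<^sub>0 L\<^sub>1 :: nat. \<forall>L\<ge>L\<^sub>1. \<forall>R b. 0 < L \<longrightarrow>
    {\<omega>\<in>space M. bad_path L (C\<^sub>0 * L ^ DIM('a)) R b (N \<omega>)} \<in> sets M \<and>
    prob {\<omega>\<in>space M. bad_path L (C\<^sub>0 * L ^ DIM('a)) R b (N \<omega>)} \<le>
      exp (exp (- \<gamma> * real L ^ DIM('a)) * R - \<beta> * real L ^ DIM('a) * real b)"
proof -
  let ?d = "DIM('a)"
  obtain \<alpha> :: real and C\<^sub>0 :: nat where \<alpha>: "\<alpha> > 0"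
    and C0: "\<And>L y. L > 0 \<Longrightarrow> y \<in> extensional Basis \<Longrightarrow>
      prob {\<omega>\<in>space M. bad_cell L (C\<^sub>0 * L ^ ?d) (N \<omega>) y} \<le> 2 * exp (- \<alpha> * real L ^ ?d)"
    using prob_bad_cell_le by blast
  have "eventually (\<lambda>L::nat. 2 * 4 ^ ?d \<le> exp (\<alpha> / 4 * real L)) at_top" using \<alpha> by real_asymp
  then obtain L\<^sub>1 where L1: "\<And>L. L \<ge> L\<^sub>1 \<Longrightarrow> 2 * 4 ^ ?d \<le> exp (\<alpha> / 4 * real L)"
    unfolding eventually_at_top_linorder by blast
  \<comment> \<open>Gives \<open>\<theta> ^ (- d) = exp (\<alpha> / 4 * V)\<close>. Another
    \<open>\<alpha> / 4\<close> absorbs the constant \<open>2 * 4 ^ d\<close>, and half of the rate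
    \<open>\<alpha>\<close> is left.\<close>
  define \<gamma> where "\<gamma> = \<alpha> / (4 * real ?d)"
  have \<gamma>: "\<gamma> > 0" using \<alpha> by (simp add: \<gamma>_def)
  have "{\<omega>\<in>space M. bad_path L (C\<^sub>0 * L ^ ?d) R b (N \<omega>)} \<in> sets M \<and>
      prob {\<omega>\<in>space M. bad_path L (C\<^sub>0 * L ^ ?d) R b (N \<omega>)} \<le>
      exp (exp (- \<gamma> * real L ^ ?d) * R - \<alpha> / 2 * real L ^ ?d * real b)"
    if L: "L \<ge> L\<^sub>1" "0 < L" for L b and R :: real
  proof -
    define V where "V = real L ^ ?d"
    define \<theta> where "\<theta> = exp (- \<gamma> * V)"
    define p where "p = 2 * exp (- \<alpha> * V)"
    have \<theta>: "0 < \<theta>" "\<theta> \<le> 1" using \<gamma> by (auto simp: \<theta>_def V_def)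
    have p0: "0 \<le> p" by (simp add: p_def)
    have p: "prob {\<omega>\<in>space M. bad_cell L (C\<^sub>0 * L ^ ?d) (N \<omega>) y} \<le> p" if "y \<in> extensional Basis" for y
      using C0[OF L(2) that] by (simp add: p_def V_def)
    have "inverse \<theta> = exp (\<gamma> * V)" by (simp add: \<theta>_def exp_minus)
    hence "(4 / \<theta>) ^ ?d = 4 ^ ?d * exp (\<gamma> * V) ^ ?d" by (simp add: divide_inverse power_mult_distrib)
    also have "exp (\<gamma> * V) ^ ?d = exp (\<alpha> / 4 * V)"
      by (simp add: exp_of_nat_mult[symmetric] \<gamma>_def)
    finally have "(4 / \<theta>) ^ ?d * p = (2 * 4 ^ ?d) * (exp (\<alpha> / 4 * V) * exp (- \<alpha> * V))"
      by (simp add: p_def)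
    also have "\<dots> \<le> exp (\<alpha> / 4 * V) * (exp (\<alpha> / 4 * V) * exp (- \<alpha> * V))"
    proof (rule mult_right_mono)
      have "2 * 4 ^ ?d \<le> exp (\<alpha> / 4 * real L)" by (rule L1[OF L(1)])
      also have "\<dots> \<le> exp (\<alpha> / 4 * V)"
        using self_le_power_DIM[of L, where 'a='a] \<alpha> by (simp add: V_def)
      finally show "2 * 4 ^ ?d \<le> exp (\<alpha> / 4 * V)" .
    qed simp
    also have "\<dots> = exp (- (\<alpha> / 2 * V))" by (simp add: exp_add[symmetric])
    finally have le: "(4 / \<theta>) ^ ?d * p \<le> exp (- (\<alpha> / 2 * V))" .
    have "prob {\<omega>\<in>space M. bad_path L (C\<^sub>0 * L ^ ?d) R b (N \<omega>)} \<le>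
        exp (\<theta> * R) * ((4 / \<theta>) ^ ?d * p) ^ b"
      by (rule prob_bad_path_le[OF L(2) \<theta> p0 p])
    also have "\<dots> \<le> exp (\<theta> * R) * exp (- (\<alpha> / 2 * V)) ^ b"
      using \<theta> p0 le by (intro mult_left_mono power_mono) auto
    also have "\<dots> = exp (\<theta> * R - \<alpha> / 2 * V * real b)"
      by (simp add: exp_of_nat_mult[symmetric] exp_add[symmetric] algebra_simps)
    finally show ?thesis
      using sets_bad_path[OF L(2) \<theta> p0 p] by (simp add: V_def \<theta>_def)
  qed
  thus ?thesis using \<alpha> \<gamma> by (intro exI[of _ "\<alpha> / 2"] exI[of _ \<gamma>] conjI exI[of _ C\<^sub>0] exI[of _ L\<^sub>1]) auto
qed

text \<open>The premise keeps \<open>n\<close> at most exponential in \<open>q ^ d\<close>; it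
  serves to exclude bad cells along the walk at the last scale \<open>q\<close>.\<close>

lemma award_tail:
  fixes k :: real
  assumes k: "0 \<le> k"
  shows "\<exists>a>0. \<exists>\<gamma>>0. \<exists>\<delta>>0. \<exists>q\<^sub>0::nat. \<forall>n\<ge>1. \<forall>q\<ge>q\<^sub>0.
    exp (- \<gamma> * real q ^ DIM('a)) * (a * (real n + real q ^ DIM('a))) \<le> 1 \<longrightarrow>
    (\<exists>E\<in>sets M. prob E \<le> exp (- \<delta> * real q ^ DIM('a)) \<and>
      (\<forall>\<omega>\<in>space M - E. \<forall>P\<in>polyominoes (N \<omega>) n.
        (\<Sum>v\<in>P. real (num_faces (N \<omega>) v) powr k) \<le> a * (real n + (real q ^ DIM('a)) powr (k + 2))))"
proof -
  let ?d = "DIM('a)"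
  obtain \<beta> \<gamma> :: real and C\<^sub>0 L\<^sub>1 :: nat where \<beta>: "\<beta> > 0" and \<gamma>: "\<gamma> > 0"
    and bp': "\<forall>L\<ge>L\<^sub>1. \<forall>R b. 0 < L \<longrightarrow>
      {\<omega>\<in>space M. bad_path L (C\<^sub>0 * L ^ ?d) R b (N \<omega>)} \<in> sets M \<and>
      prob {\<omega>\<in>space M. bad_path L (C\<^sub>0 * L ^ ?d) R b (N \<omega>)} \<le>
      exp (exp (- \<gamma> * real L ^ ?d) * R - \<beta> * real L ^ ?d * real b)"
    using prob_bad_path_le_exp by (elim exE conjE) (rule that)
  have bp: "{\<omega>\<in>space M. bad_path L (C\<^sub>0 * L ^ ?d) R b (N \<omega>)} \<in> sets M"
    "prob {\<omega>\<in>space M. bad_path L (C\<^sub>0 * L ^ ?d) R b (N \<omega>)} \<le>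
      exp (exp (- \<gamma> * real L ^ ?d) * R - \<beta> * real L ^ ?d * real b)"
    if "L \<ge> L\<^sub>1" "0 < L" for L R b
    using bp'[rule_format, OF that] by simp_all
  define h where "h = 2 * ?d + 2"
  define c where "c = (2 * h + 1) ^ ?d"
  define \<kappa> where "\<kappa> = 3 * ?d * (2 * h + 1)"
  define u where "u = c * C\<^sub>0"
  have h_ge: "2 * ?d + 2 \<le> h" by (simp add: h_def)
  have c: "real c > 0" by (simp add: c_def)
  have "\<kappa> > 0" by (simp add: \<kappa>_def)
  hence \<kappa>: "real \<kappa> > 0" by simp
  \<comment> \<open>From scale \<open>L\<^sub>2\<close> on, the bad cells due to the length of the
    walk use up at most half of the budget \<open>m\<close> of unit cells.\<close>
  have "((\<lambda>L::nat. real c / \<beta> * exp (- \<gamma> * real L) * real \<kappa>) \<longlongrightarrow> 0) at_top"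
    using \<gamma> \<beta> c \<kappa> by real_asymp
  hence "eventually (\<lambda>L::nat. real c / \<beta> * exp (- \<gamma> * real L) * real \<kappa> < 1 / 2) at_top"
    by (rule order_tendstoD) simp
  then obtain L\<^sub>2 where L2: "\<And>L. L \<ge> L\<^sub>2 \<Longrightarrow> real c / \<beta> * exp (- \<gamma> * real L) * real \<kappa> < 1 / 2"
    unfolding eventually_at_top_linorder by blast
  \<comment> \<open>Absorbs the number of scales in the union bound into half of the exponent
    \<open>T\<close>.\<close>
  have "eventually (\<lambda>q::nat. real q \<le> exp (\<beta> / 4 * real q)) at_top" using \<beta> by real_asymp
  then obtain q\<^sub>1 where q1: "\<And>q. q \<ge> q\<^sub>1 \<Longrightarrow> real q \<le> exp (\<beta> / 4 * real q)"
    unfolding eventually_at_top_linorder by blast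
  define L\<^sub>0 where "L\<^sub>0 = max 1 (max L\<^sub>1 L\<^sub>2)"
  have L0: "L\<^sub>0 > 0" "L\<^sub>0 \<ge> L\<^sub>1" "L\<^sub>0 \<ge> L\<^sub>2" by (auto simp: L\<^sub>0_def)
  define A where "A = (2 * (?d * L\<^sub>0) + 1) ^ ?d"
  define g where "g L = real (u * L ^ ?d) powr k" for L
  define S where "S = (\<Sum>L. exp (- \<gamma> * real L ^ ?d) * g (Suc L))"
  have g0: "0 \<le> g L" for L by (simp add: g_def)
  have summ: "summable (\<lambda>L. exp (- \<gamma> * real L ^ ?d) * g (Suc L))"
    unfolding g_def using \<gamma> k DIM_positive[where 'a='a] by (intro summable_exp_powr) auto
  have S0: "0 \<le> S" unfolding S_def by (intro suminf_nonneg summ) (simp add: g0)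
  define a\<^sub>1 where "a\<^sub>1 = real c * real u * 2 ^ ?d / \<beta>"
  have a1: "0 \<le> a\<^sub>1" using \<beta> by (simp add: a\<^sub>1_def)
  \<comment> \<open>Collects the coefficients of the final estimate; the last summand is the one
    needed for \<open>bq\<close>.\<close>
  define a where "a = g L\<^sub>0 + a\<^sub>1 * S * real \<kappa> * (2 * real A) + a\<^sub>1 * S * real \<kappa> * real c +
    a\<^sub>1 * \<beta> * real u powr k / 2 + 2 * real \<kappa> / \<beta> * (2 * real A + real c)"
  have parts: "0 \<le> g L\<^sub>0" "0 \<le> a\<^sub>1 * S * real \<kappa> * (2 * real A)" "0 \<le> a\<^sub>1 * S * real \<kappa> * real c"
    "0 \<le> a\<^sub>1 * \<beta> * real u powr k / 2" "0 < 2 * real \<kappa> / \<beta> * (2 * real A + real c)"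
    using a1 S0 \<beta> c \<kappa> g0 by (auto intro!: add_nonneg_pos)
  have a_pos: "0 < a" using parts unfolding a_def by linarith
  have main: "\<exists>E\<in>sets M. prob E \<le> exp (- (\<beta> / 4) * real q ^ ?d) \<and>
      (\<forall>\<omega>\<in>space M - E. \<forall>P\<in>polyominoes (N \<omega>) n.
        (\<Sum>v\<in>P. real (num_faces (N \<omega>) v) powr k) \<le> a * (real n + (real q ^ ?d) powr (k + 2)))"
    if n: "n \<ge> 1" and q: "q \<ge> max q\<^sub>1 L\<^sub>0"
      and cond: "exp (- \<gamma> * real q ^ ?d) * (a * (real n + real q ^ ?d)) \<le> 1" for n q
  proof -
    define Q where "Q = real q ^ ?d"
    define T where "T = \<beta> * Q / 2"
    \<comment> \<open>Chosen so that \<open>n * A = (m - c * Q) / 2\<close>. In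
      \<open>m_cond\<close> the bad cells add at most \<open>m / 2\<close> through the length of the
      walk and \<open>c * Q / 2\<close> through \<open>T\<close>, which makes \<open>m\<close> in
      total.\<close>
    define m where "m = 2 * n * A + c * q ^ ?d"
    define R where "R = real (?d * (2 * h + 1) * (2 * m + 1))"
    define \<theta> where "\<theta> L = exp (- \<gamma> * real L ^ ?d)" for L :: nat
    \<comment> \<open>Solves \<open>\<theta> L * R - \<beta> * L ^ d * \<tau> L = - T\<close>. With
      its ceiling \<open>b L\<close>, a bad path has probability at most \<open>exp (- T)\<close> at
      every scale used.\<close>
    define \<tau> where "\<tau> L = (\<theta> L * R + T) / (\<beta> * real L ^ ?d)" for L :: nat
    define b where "b L = nat \<lceil>\<tau> L\<rceil>" for L
    have q_pos: "q \<ge> 1" "q \<ge> L\<^sub>0" "q \<ge> q\<^sub>1" using q L0 by auto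
    have Q: "1 \<le> Q" "real q \<le> Q"
      using q_pos self_le_power_DIM[of q, where 'a='a] by (auto simp: Q_def)
    have T: "0 < T" using \<beta> Q by (simp add: T_def)
    have R0: "0 \<le> R" by (simp add: R_def)
    have m_real: "real m = 2 * real n * real A + real c * Q" by (simp add: m_def Q_def)
    have "A \<ge> 1" by (simp add: A_def)
    hence "1 * 1 \<le> n * A" using n by (intro mult_le_mono)
    hence "m \<ge> 1" unfolding m_def mult.assoc by linarith
    have "?d * (2 * h + 1) * (2 * m + 1) \<le> ?d * (2 * h + 1) * (3 * m)"
      using \<open>m \<ge> 1\<close> by (intro mult_left_mono) auto
    also have "\<dots> = \<kappa> * m" by (simp add: \<kappa>_def)
    finally have Rm: "R \<le> real \<kappa> * real m" unfolding R_def of_nat_mult[symmetric] of_nat_le_iff .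
    have \<theta>0: "0 < \<theta> L" for L by (simp add: \<theta>_def)
    have \<tau>0: "0 < \<tau> L" if "L > 0" for L
      using that T \<theta>0[of L] R0 \<beta> by (auto simp: \<tau>_def intro!: divide_pos_pos add_nonneg_pos)
    have b_ge: "\<tau> L \<le> real (b L)" for L unfolding b_def by (rule real_nat_ceiling_ge)
    \<comment> \<open>Rounding up adds less than 1, and without a bad path of \<open>b L\<close>
      cells at most \<open>b L - 1\<close> bad cells remain.\<close>
    have b_le: "real (b L - 1) \<le> \<tau> L" if "L > 0" for L
      using \<tau>0[OF that] unfolding b_def by linarith
    \<comment> \<open>The premise gives \<open>\<theta> q * R \<le> T\<close>, hence
      \<open>0 < \<tau> q \<le> 1\<close>: at scale \<open>q\<close> a single bad cell is already
      too unlikely.\<close>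
    have bq: "b q = 1"
    proof -
      have "\<theta> q * R \<le> \<theta> q * (real \<kappa> * (2 * real n * real A + real c * Q))"
        using Rm unfolding m_real[symmetric] by (intro mult_left_mono) (auto simp: \<theta>_def)
      also have "\<dots> \<le> \<theta> q * (real \<kappa> * ((2 * real A + real c) * (real n + Q)))"
        using Q by (intro mult_left_mono) (auto simp: \<theta>_def algebra_simps)
      also have "\<dots> = \<beta> / 2 * (\<theta> q * (2 * real \<kappa> / \<beta> * (2 * real A + real c) * (real n + Q)))"
        using \<beta> by (simp add: field_simps)
      also have "\<dots> \<le> \<beta> / 2 * (\<theta> q * (a * (real n + Q)))"
      proof (intro mult_left_mono mult_right_mono)
        show "2 * real \<kappa> / \<beta> * (2 * real A + real c) \<le> a" using parts unfolding a_def by linarith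
      qed (use \<beta> Q \<theta>0[of q] in auto)
      also have "\<dots> \<le> \<beta> / 2 * 1"
        using cond \<beta> by (intro mult_left_mono) (auto simp: \<theta>_def Q_def)
      also have "\<dots> \<le> T" using \<beta> Q by (simp add: T_def)
      finally have "\<theta> q * R + T \<le> \<beta> * Q" by (simp add: T_def)
      moreover have "0 < \<beta> * Q" using \<beta> Q by simp
      ultimately have "\<tau> q \<le> 1" unfolding \<tau>_def Q_def by simp
      moreover have "0 < \<tau> q" using \<tau>0 q_pos by auto
      ultimately have "\<lceil>\<tau> q\<rceil> = 1" by (intro ceiling_unique) auto
      thus ?thesis by (simp add: b_def)
    qed
    have m_cond: "n * A + L\<^sub>0 ^ ?d * (c * (b L\<^sub>0 - 1)) \<le> m"
    proof -
      have "real (L\<^sub>0 ^ ?d * (c * (b L\<^sub>0 - 1))) \<le> real L\<^sub>0 ^ ?d * (real c * \<tau> L\<^sub>0)"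
        using b_le[OF L0(1)] by (simp add: mult_left_mono)
      also have "\<dots> = real c / \<beta> * (\<theta> L\<^sub>0 * R + T)"
        using L0 \<beta> by (simp add: \<tau>_def field_simps)
      also have "\<dots> = real c / \<beta> * \<theta> L\<^sub>0 * R + real c * Q / 2"
        using \<beta> by (simp add: T_def field_simps)
      also have "real c / \<beta> * \<theta> L\<^sub>0 * R \<le> real c / \<beta> * exp (- \<gamma> * real L\<^sub>0) * (real \<kappa> * real m)"
        using self_le_power_DIM[of L\<^sub>0, where 'a='a] \<gamma> \<beta> R0 Rm
        by (intro mult_mono) (auto simp: \<theta>_def)
      also have "\<dots> \<le> 1 / 2 * real m"
        using mult_right_mono[OF less_imp_le[OF L2[OF L0(3)]], of "real m"] by (simp only: mult.assoc)
      finally have "real (L\<^sub>0 ^ ?d * (c * (b L\<^sub>0 - 1))) \<le> 1 / 2 * real m + real c * Q / 2" by simp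
      moreover have "real (n * A) = (real m - real c * Q) / 2" using m_real by simp
      ultimately have "real (n * A + L\<^sub>0 ^ ?d * (c * (b L\<^sub>0 - 1))) \<le> real m"
        unfolding of_nat_add by argo
      thus ?thesis by (simp only: of_nat_le_iff)
    qed
    define E where "E = (\<Union>L\<in>{L\<^sub>0..q}. {\<omega>\<in>space M. bad_path L (C\<^sub>0 * L ^ ?d) R (b L) (N \<omega>)})"
    have E: "E \<in> sets M" unfolding E_def using L0 by (intro sets.finite_UN bp) auto
    have "prob E \<le> (\<Sum>L = L\<^sub>0..q. prob {\<omega>\<in>space M. bad_path L (C\<^sub>0 * L ^ ?d) R (b L) (N \<omega>)})"
      unfolding E_def using L0 by (intro finite_measure_subadditive_finite) (auto intro!: bp)
    also have "\<dots> \<le> (\<Sum>L = L\<^sub>0..q. exp (- T))"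
    proof (rule sum_mono)
      fix L assume L: "L \<in> {L\<^sub>0..q}"
      have "\<theta> L * R + T = \<beta> * real L ^ ?d * \<tau> L" using \<beta> L L0 by (simp add: \<tau>_def)
      also have "\<dots> \<le> \<beta> * real L ^ ?d * real (b L)" using \<beta> b_ge by (intro mult_left_mono) auto
      finally have "exp (\<theta> L * R - \<beta> * real L ^ ?d * real (b L)) \<le> exp (- T)" by simp
      moreover have "prob {\<omega>\<in>space M. bad_path L (C\<^sub>0 * L ^ ?d) R (b L) (N \<omega>)} \<le>
          exp (\<theta> L * R - \<beta> * real L ^ ?d * real (b L))"
        unfolding \<theta>_def using L L0 by (intro bp) auto
      ultimately show "prob {\<omega>\<in>space M. bad_path L (C\<^sub>0 * L ^ ?d) R (b L) (N \<omega>)} \<le> exp (- T)" by linarith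
    qed
    also have "\<dots> = real (Suc q - L\<^sub>0) * exp (- T)" by simp
    also have "\<dots> \<le> real q * exp (- T)" using L0 by (intro mult_right_mono) auto
    also have "\<dots> \<le> exp (\<beta> / 4 * Q) * exp (- T)"
    proof (rule mult_right_mono)
      have "exp (\<beta> / 4 * real q) \<le> exp (\<beta> / 4 * Q)" using Q \<beta> by simp
      thus "real q \<le> exp (\<beta> / 4 * Q)" using q1[OF q_pos(3)] by linarith
    qed simp
    also have "\<dots> = exp (- (\<beta> / 4) * Q)" by (simp add: exp_add[symmetric] T_def)
    finally have prob_E: "prob E \<le> exp (- (\<beta> / 4) * Q)" .
    have "(\<Sum>v\<in>P. real (num_faces (N \<omega>) v) powr k) \<le> a * (real n + Q powr (k + 2))"
      if \<omega>: "\<omega> \<in> space M - E" and P: "P \<in> polyominoes (N \<omega>) n" for \<omega> P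
    proof -
      have no: "\<not> bad_path L (C\<^sub>0 * L ^ ?d) R (b L) (N \<omega>)" if "L\<^sub>0 \<le> L" "L \<le> q" for L
        using \<omega> that by (auto simp: E_def)
      have "(\<Sum>v\<in>P. real (num_faces (N \<omega>) v) powr k) \<le> real n * g L\<^sub>0 +
          (\<Sum>L = L\<^sub>0..<q. real (c * (b L - 1)) * real (u * Suc L ^ ?d) * g (Suc L))"
        using polyomino_award_le[where cap = "\<lambda>L. C\<^sub>0 * L ^ ?d",
            OF h_ge L0(1) q_pos(2) k P eq_refl[OF R_def[symmetric]] no bq m_cond[unfolded A_def c_def]]
        unfolding g_def u_def c_def by (simp only: mult.assoc)
      \<comment> \<open>The \<open>L ^ d\<close> from the nuclei per cell cancels the denominator of
        \<open>\<tau> L\<close>. In the part with \<open>R\<close> the factor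
        \<open>\<theta> L\<close> makes the sum over scales converge; the part with \<open>T\<close>
        is at most its value at \<open>q\<close>, for at most \<open>q\<close> scales.\<close>
      also have "(\<Sum>L = L\<^sub>0..<q. real (c * (b L - 1)) * real (u * Suc L ^ ?d) * g (Suc L)) \<le>
          (\<Sum>L = L\<^sub>0..<q. a\<^sub>1 * R * (\<theta> L * g (Suc L)) + a\<^sub>1 * T * g q)"
      proof (rule sum_mono)
        fix L assume L: "L \<in> {L\<^sub>0..<q}"
        hence Lp: "L > 0" using L0 by auto
        have "real (c * (b L - 1)) \<le> real c * \<tau> L" using b_le[OF Lp] by (simp add: mult_left_mono)
        moreover have "real (u * Suc L ^ ?d) \<le> real u * (2 ^ ?d * real L ^ ?d)"
        proof -
          have "real (Suc L) ^ ?d \<le> (2 * real L) ^ ?d" using Lp by (intro power_mono) auto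
          thus ?thesis by (simp add: power_mult_distrib mult_left_mono)
        qed
        ultimately have "real (c * (b L - 1)) * real (u * Suc L ^ ?d) \<le>
            real c * \<tau> L * (real u * (2 ^ ?d * real L ^ ?d))"
          using \<tau>0[OF Lp] by (intro mult_mono) auto
        also have "\<dots> = a\<^sub>1 * (\<theta> L * R + T)"
          using Lp \<beta> by (simp add: a\<^sub>1_def \<tau>_def field_simps)
        finally have "real (c * (b L - 1)) * real (u * Suc L ^ ?d) * g (Suc L) \<le>
            a\<^sub>1 * (\<theta> L * R + T) * g (Suc L)" using g0 by (rule mult_right_mono)
        also have "\<dots> = a\<^sub>1 * R * (\<theta> L * g (Suc L)) + a\<^sub>1 * T * g (Suc L)" by (simp add: algebra_simps)
        also have "a\<^sub>1 * T * g (Suc L) \<le> a\<^sub>1 * T * g q"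
        proof (rule mult_left_mono)
          have "u * Suc L ^ ?d \<le> u * q ^ ?d" using L by (intro mult_left_mono power_mono) auto
          thus "g (Suc L) \<le> g q" unfolding g_def using k by (intro powr_mono2) (simp_all only: of_nat_le_iff of_nat_0_le_iff)
        qed (use a1 T in auto)
        finally show "real (c * (b L - 1)) * real (u * Suc L ^ ?d) * g (Suc L) \<le>
            a\<^sub>1 * R * (\<theta> L * g (Suc L)) + a\<^sub>1 * T * g q" by simp
      qed
      also have "\<dots> = a\<^sub>1 * R * (\<Sum>L = L\<^sub>0..<q. \<theta> L * g (Suc L)) + real (q - L\<^sub>0) * (a\<^sub>1 * T * g q)"
        by (simp add: sum.distrib sum_distrib_left)
      also have "\<dots> \<le> a\<^sub>1 * R * S + Q * (a\<^sub>1 * T * g q)"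
      proof (intro add_mono mult_left_mono mult_right_mono)
        show "(\<Sum>L = L\<^sub>0..<q. \<theta> L * g (Suc L)) \<le> S"
          unfolding S_def \<theta>_def by (intro sum_le_suminf summ) (auto simp: g0)
        show "real (q - L\<^sub>0) \<le> Q" using Q by linarith
      qed (use a1 R0 T g0 in auto)
      also have "a\<^sub>1 * R * S \<le> a\<^sub>1 * (real \<kappa> * (2 * real n * real A + real c * Q)) * S"
        using Rm a1 S0 unfolding m_real by (intro mult_right_mono mult_left_mono) auto
      also have "\<dots> = a\<^sub>1 * S * real \<kappa> * (2 * real A) * real n + a\<^sub>1 * S * real \<kappa> * real c * Q"
        by (simp add: algebra_simps)
      \<comment> \<open>Source of the exponent \<open>k + 2\<close>: \<open>Q ^ k\<close> is the
        award of a tile, one more factor comes from \<open>T\<close>, and one from bounding the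
        number of scales by \<open>Q\<close>.\<close>
      also have "Q * (a\<^sub>1 * T * g q) = a\<^sub>1 * \<beta> * real u powr k / 2 * Q powr (k + 2)"
      proof -
        have "Q powr (k + 2) = Q powr k * Q ^ 2" using Q by (simp add: powr_add)
        moreover have "g q = real u powr k * Q powr k" by (simp add: g_def Q_def powr_mult)
        ultimately show ?thesis by (simp add: T_def power2_eq_square)
      qed
      also have "a\<^sub>1 * S * real \<kappa> * real c * Q \<le> a\<^sub>1 * S * real \<kappa> * real c * Q powr (k + 2)"
      proof (rule mult_left_mono)
        have "Q powr 1 \<le> Q powr (k + 2)" using Q k by (intro powr_mono) auto
        thus "Q \<le> Q powr (k + 2)" using Q by simp
      qed (use parts in auto)
      finally have "(\<Sum>v\<in>P. real (num_faces (N \<omega>) v) powr k) \<le>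
          real n * (g L\<^sub>0 + a\<^sub>1 * S * real \<kappa> * (2 * real A)) +
          (a\<^sub>1 * S * real \<kappa> * real c + a\<^sub>1 * \<beta> * real u powr k / 2) * Q powr (k + 2)"
        by (simp add: algebra_simps)
      also have "\<dots> \<le> real n * a + a * Q powr (k + 2)"
      proof (rule add_mono[OF mult_left_mono mult_right_mono])
        show "g L\<^sub>0 + a\<^sub>1 * S * real \<kappa> * (2 * real A) \<le> a"
          "a\<^sub>1 * S * real \<kappa> * real c + a\<^sub>1 * \<beta> * real u powr k / 2 \<le> a"
          using parts unfolding a_def by linarith+
      qed simp_all
      finally show ?thesis by (simp add: algebra_simps)
    qed
    thus ?thesis using E prob_E by (intro bexI[of _ E]) (auto simp: Q_def)
  qed
  show ?thesis
    using a_pos \<gamma> \<beta> main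
    by (intro exI[of _ a] exI[of _ \<gamma>] exI[of _ "\<beta> / 4"] exI[of _ "max q\<^sub>1 L\<^sub>0"] conjI allI impI) auto
qed

end

(* The outer measure agrees with the probability on measurable sets. It keeps the bound meaningful
   without taking for granted that the event is measurable with respect to the (not necessarily
   complete) probability space M; a plain "measure M" would be 0 on a non-measurable set. *)
theorem corollary1p1:
  fixes M :: "'w measure" and \<mu> :: "'a::euclidean_space measure"
    and N :: "'w \<Rightarrow> 'a set" and k :: real
  assumes "2 \<le> DIM('a)"
    and "comparable_to_lebesgue \<mu>"
    and "poisson_random_set M \<mu> N"
    and "0 \<le> k"
  shows "\<exists>z\<^sub>0 K :: real. 0 < z\<^sub>0 \<and> 0 < K \<and>
    (\<forall>(n::nat) (z::real). 1 \<le> n \<longrightarrow> z\<^sub>0 \<le> z \<longrightarrow>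
       outer_measure_of M {\<omega>\<in>space M. ennreal z \<le> greedy_award (N \<omega>) k n / of_nat n}
         \<le> ennreal (exp (- K * (real n * z) powr (1 / (k + 2)))))"
proof -
  let ?d = "DIM('a)"
  interpret prob_space M using assms(3) by (simp add: poisson_random_set_def)
  interpret poisson_set M \<mu> N by unfold_locales (rule assms)+
  obtain a \<gamma> \<delta> :: real and q\<^sub>0 :: nat where a: "a > 0" and \<gamma>: "\<gamma> > 0" and \<delta>: "\<delta> > 0"
    and tail: "\<forall>n\<ge>1. \<forall>q\<ge>q\<^sub>0.
      exp (- \<gamma> * real q ^ ?d) * (a * (real n + real q ^ ?d)) \<le> 1 \<longrightarrow>
      (\<exists>E\<in>sets M. prob E \<le> exp (- \<delta> * real q ^ ?d) \<and>
      (\<forall>\<omega>\<in>space M - E. \<forall>P\<in>polyominoes (N \<omega>) n.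
        (\<Sum>v\<in>P. real (num_faces (N \<omega>) v) powr k) \<le> a * (real n + (real q ^ ?d) powr (k + 2))))"
    using award_tail[OF assms(4)] by (elim exE conjE) (rule that)
  define w :: real where "w = 2 ^ ?d"
  have w: "w > 0" by (simp add: w_def)
  \<comment> \<open>For \<open>x = q ^ d\<close> this becomes the premise of
    \<open>award_tail\<close>, since \<open>n \<le> n * z\<close> will be at most
    \<open>4 * a * (w * x) powr (k + 2)\<close>.\<close>
  have "eventually (\<lambda>x::real. exp (- \<gamma> * x) * (a * (4 * a * (w * x) powr (k + 2) + x)) \<le> 1) at_top"
    using \<gamma> a w by real_asymp
  then obtain x\<^sub>0 where x0: "\<And>x. x \<ge> x\<^sub>0 \<Longrightarrow> exp (- \<gamma> * x) * (a * (4 * a * (w * x) powr (k + 2) + x)) \<le> 1"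
    unfolding eventually_at_top_linorder by blast
  define q\<^sub>2 where "q\<^sub>2 = max 1 (max q\<^sub>0 (nat \<lceil>x\<^sub>0\<rceil>))"
  \<comment> \<open>The entry \<open>4 * a\<close> makes \<open>a * n\<close> at most a quarter of
    \<open>n * z\<close>; the last entry puts \<open>q\<^sub>2\<close> into the set \<open>I\<close>
    below, so that the scale chosen there is above all thresholds.\<close>
  define z\<^sub>0 where "z\<^sub>0 = max 1 (max (4 * a) (4 * a * (real q\<^sub>2 ^ ?d) powr (k + 2)))"
  define K where "K = \<delta> / ((4 * a) powr (1 / (k + 2)) * w)"
  have K: "K > 0" using \<delta> a w by (simp add: K_def)
  have "outer_measure_of M {\<omega>\<in>space M. ennreal z \<le> greedy_award (N \<omega>) k n / of_nat n}
      \<le> ennreal (exp (- K * (real n * z) powr (1 / (k + 2))))"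
    if n: "1 \<le> n" and z: "z\<^sub>0 \<le> z" for n :: nat and z :: real
  proof -
    define s where "s = real n * z"
    have z1: "z \<ge> 1" "z \<ge> 4 * a" "z \<ge> 4 * a * (real q\<^sub>2 ^ ?d) powr (k + 2)"
      using z by (auto simp: z\<^sub>0_def)
    have sz: "z \<le> s" "real n \<le> s" using n z1 mult_right_mono[of 1 "real n" z] mult_left_mono[of 1 z "real n"]
      by (auto simp: s_def)
    \<comment> \<open>The scale will be the largest whose term \<open>a * Q powr (k + 2)\<close> is
      at most \<open>s / 4\<close>. By maximality \<open>s\<close> is smaller than the bound for
      \<open>Suc q\<close>, and \<open>Suc q \<le> 2 * q\<close> costs only the factor
      \<open>w\<close>.\<close>
    define I where "I = {q::nat. 4 * a * (real q ^ ?d) powr (k + 2) \<le> s}"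
    define q where "q = Max I"
    have "I \<subseteq> {..max 1 (nat \<lceil>s / (4 * a)\<rceil>)}"
    proof
      fix q assume q: "q \<in> I"
      show "q \<in> {..max 1 (nat \<lceil>s / (4 * a)\<rceil>)}"
      proof (cases "q \<ge> 1")
        case True
        have "real q \<le> real q ^ ?d" by (rule self_le_power_DIM)
        also have "\<dots> = (real q ^ ?d) powr 1" using True by simp
        also have "\<dots> \<le> (real q ^ ?d) powr (k + 2)" using True assms(4) by (intro powr_mono) auto
        also have "\<dots> \<le> s / (4 * a)" using q a by (simp add: I_def field_simps)
        finally show ?thesis by (simp add: le_max_iff_disj le_nat_iff) linarith
      qed auto
    qed
    hence finI: "finite I" by (rule finite_subset) simp
    have q2I: "q\<^sub>2 \<in> I" using z1(3) sz(1) by (simp add: I_def)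
    have qI: "q \<in> I" unfolding q_def using finI q2I by (intro Max_in) auto
    have q_ge: "q \<ge> q\<^sub>2" unfolding q_def using finI q2I by (intro Max_ge)
    have "Suc q \<notin> I" using Max_ge[OF finI, of "Suc q"] by (auto simp: q_def)
    hence s_less: "s < 4 * a * (real (Suc q) ^ ?d) powr (k + 2)" by (simp add: I_def not_le)
    define Q where "Q = real q ^ ?d"
    have q1: "q \<ge> 1" "q \<ge> q\<^sub>0" "real q \<ge> x\<^sub>0" using q_ge by (auto simp: q\<^sub>2_def)
    have "real q \<le> Q" unfolding Q_def by (rule self_le_power_DIM)
    hence Q: "1 \<le> Q" "x\<^sub>0 \<le> Q" using q1 by auto
    have "real (Suc q) ^ ?d \<le> (2 * real q) ^ ?d" using q1 by (intro power_mono) auto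
    hence SQ: "real (Suc q) ^ ?d \<le> w * Q" by (simp add: w_def Q_def power_mult_distrib)
    have s_le: "s \<le> 4 * a * (w * Q) powr (k + 2)"
    proof -
      have "(real (Suc q) ^ ?d) powr (k + 2) \<le> (w * Q) powr (k + 2)"
        using SQ assms(4) by (intro powr_mono2) auto
      hence "4 * a * (real (Suc q) ^ ?d) powr (k + 2) \<le> 4 * a * (w * Q) powr (k + 2)"
        using a by (intro mult_left_mono) auto
      thus ?thesis using s_less by linarith
    qed
    have "exp (- \<gamma> * Q) * (a * (real n + Q)) \<le> exp (- \<gamma> * Q) * (a * (4 * a * (w * Q) powr (k + 2) + Q))"
      using a s_le sz by (intro mult_left_mono add_right_mono) auto
    also have "\<dots> \<le> 1" by (rule x0[OF Q(2)])
    finally obtain E where E: "E \<in> sets M" "prob E \<le> exp (- \<delta> * Q)"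
      and bound: "\<And>\<omega> P. \<omega> \<in> space M - E \<Longrightarrow> P \<in> polyominoes (N \<omega>) n \<Longrightarrow>
        (\<Sum>v\<in>P. real (num_faces (N \<omega>) v) powr k) \<le> a * (real n + Q powr (k + 2))"
      using tail[rule_format, OF n q1(2)] unfolding Q_def by blast
    \<comment> \<open>Two quarters of \<open>s\<close>; the other half leaves room for a strict
      contradiction with an award of at least \<open>s\<close>.\<close>
    have half: "a * (real n + Q powr (k + 2)) \<le> s / 2"
    proof -
      have "4 * a * real n \<le> z * real n" using z1(2) by (intro mult_right_mono) auto
      moreover have "4 * a * Q powr (k + 2) \<le> s" using qI by (simp add: I_def Q_def)
      ultimately show ?thesis by (simp add: s_def algebra_simps)
    qed
    \<comment> \<open>Outside \<open>E\<close> the award divided by \<open>n\<close> is at most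
      \<open>z / 2\<close>, so the event, measurable or not, lies in the measurable set
      \<open>E\<close>.\<close>
    have "{\<omega>\<in>space M. ennreal z \<le> greedy_award (N \<omega>) k n / of_nat n} \<subseteq> E"
    proof (rule subsetI, rule ccontr)
      fix \<omega> assume \<omega>: "\<omega> \<in> {\<omega>\<in>space M. ennreal z \<le> greedy_award (N \<omega>) k n / of_nat n}" "\<omega> \<notin> E"
      have "(\<Sum>v\<in>P. real (num_faces (N \<omega>) v) powr k) \<le> s / 2"
        if "P \<in> polyominoes (N \<omega>) n" for P
        using \<omega> by (intro order_trans[OF bound half] that) simp
      hence "greedy_award (N \<omega>) k n \<le> ennreal (s / 2)"
        unfolding greedy_award_def by (intro SUP_least ennreal_leI)
      hence "greedy_award (N \<omega>) k n / of_nat n \<le> ennreal (s / 2) / of_nat n"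
        by (rule divide_right_mono_ennreal)
      also have "\<dots> = ennreal (z / 2)"
        using n z1 by (simp add: s_def ennreal_of_nat_eq_real_of_nat divide_ennreal)
      also have "\<dots> < ennreal z" using z1 by (intro ennreal_lessI) auto
      finally show False using \<omega>(1) leD by blast
    qed
    hence "outer_measure_of M {\<omega>\<in>space M. ennreal z \<le> greedy_award (N \<omega>) k n / of_nat n} \<le>
        outer_measure_of M E" by (rule outer_measure_of_mono)
    also have "\<dots> = ennreal (prob E)" using E(1) by (simp add: emeasure_eq_measure)
    also have "\<dots> \<le> ennreal (exp (- K * s powr (1 / (k + 2))))"
    proof (rule ennreal_leI)
      have "s powr (1 / (k + 2)) \<le> (4 * a * (w * Q) powr (k + 2)) powr (1 / (k + 2))"
        using s_le sz z1 assms(4) by (intro powr_mono2) auto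
      also have "\<dots> = (4 * a) powr (1 / (k + 2)) * (w * Q)"
        using a w Q assms(4) by (simp add: powr_mult powr_powr)
      finally have "K * s powr (1 / (k + 2)) \<le> K * ((4 * a) powr (1 / (k + 2)) * (w * Q))"
        using K by (intro mult_left_mono) auto
      also have "\<dots> = \<delta> * Q" using a w by (simp add: K_def)
      finally have "exp (- \<delta> * Q) \<le> exp (- K * s powr (1 / (k + 2)))" by simp
      thus "prob E \<le> exp (- K * s powr (1 / (k + 2)))" using E(2) by linarith
    qed
    finally show ?thesis by (simp only: s_def)
  qed
  thus ?thesis using K by (intro exI[of _ z\<^sub>0] exI[of _ K]) (auto simp: z\<^sub>0_def)
qed

end
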